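(* Let $\lambda=[\lambda_1,\ldots,\lambda_k]$ be a partition and $n$ a positive integer. For a face $F$ of $P(\lambda,n)$, let $\psi(F)=\bigcup_M g(M)$, the union over the matrices $M\in M(\lambda,n)$ that are vertices of $F$. Then $\psi$ is a bijection between faces of $P(\lambda,n)$ and components of $\overline\Gamma_{(\lambda,n)}$; moreover $\psi$ is an isomorphism of posets (faces ordered by inclusion, components by containment), and $\dim F$ equals the number of regions $\mathcal{R}(\psi(F))$.
   Context: A partition is a weakly decreasing sequence of positive integers $\lambda=[\lambda_1,\ldots,\lambda_k]$; $a_i$ is the number of parts equal to $i$. A sign matrix is a matrix with entries in $\{-1,0,1\}$ whose column partial sums from the top lie in $\{0,1\}$ and whose row partial sums from the left are nonnegative. $M(\lambda,n)$ is the set of $\lambda_1\times n$ sign matrices whose $i$-th row sums to $a_{\lambda_1-i+1}$; $P(\lambda,n)$ is its convex hull in $\mathbb{R}^{\lambda_1 n}$ (whose vertices are exactly $M(\lambda,n)$). The grid graph $\Gamma_{(\lambda_1,n)}$ has vertices $(i,j)$, $1\le i\le\lambda_1+1$, $1\le j\le n+1$, drawn as a rectangular grid, with a vertical edge $(i,j)$–$(i+1,j)$ and a horizontal edge $(i,j)$–$(i,j+1)$ for each $1\le i\le\lambda_1$, $1\le j\le n$; vertices with $i=\lambda_1+1$ or $j=n+1$ are boundary vertices. For $M\in M(\lambda,n)$ with column partial sums $c_{ij}$ and row partial sums $r_{ij}$, the $0$-dimensional component $g(M)$ labels the vertical edge $(i,j)$–$(i+1,j)$ by $\{c_{ij}\}$,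 the horizontal edge $(i,j)$–$(i,j+1)$ for $j<n$ by $0$ if $r_{ij}=0$ and $\star$ otherwise, and the last horizontal edge $(i,n)$–$(i,n+1)$ by the fixed value $a_{\lambda_1-i+1}$. The union of labelings takes unions of label sets on vertical edges, $\star$ if either label is $\star$ (else $0$) on the non-final horizontal edges, and keeps the fixed labels on final horizontal edges. A component of $\overline\Gamma_{(\lambda,n)}$ is the empty labeling (empty component) or a union of a nonempty set of $0$-dimensional components $g(M)$, $M\in M(\lambda,n)$; containment is edgewise inclusion of labels with $0\subseteq\star$. Darkened edges are vertical edges labeled $\{0,1\}$ and horizontal edges labeled $\star$. $\mathcal{R}(\delta)$ is the number of bounded faces of the planar graph of darkened edges of $\delta$, with darkened edges ending at right/bottom boundary vertices regarded as meeting at one point in the exterior region; $\mathcal{R}$ of the empty component is $-1$, and the empty face has dimension $-1$. *)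

theory Defs
  imports "HOL-Analysis.Analysis"
begin

text \<open>
  The row index type 'm has \<open>\<lambda>\<^sub>1\<close> elements (an assumption of the theorem) and the column
  index type 'n has \<open>n\<close> elements, so that \<open>n\<close> is \<open>CARD('n)\<close> and is not passed as a
  separate argument. Rows and columns are ordered by the linear orders on these types.
\<close>

definition is_partition :: "nat list \<Rightarrow> bool" where
  "is_partition p \<longleftrightarrow> p \<noteq> [] \<and> sorted_wrt (\<ge>) p \<and> (\<forall>x\<in>set p. 0 < x)"

text \<open>The 1-based position of an index: the \<open>i\<close> of ``the \<open>i\<close>-th row''.\<close>

definition pos :: "'a::{finite,linorder} \<Rightarrow> nat" where
  "pos i = card {..i}"

definition col_partial_sum ::
    "real^'n::{finite,linorder}^'m::{finite,linorder} \<Rightarrow> 'm \<Rightarrow> 'n \<Rightarrow> real" where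
  "col_partial_sum X i j = (\<Sum>k\<le>i. X $ k $ j)"

definition row_partial_sum ::
    "real^'n::{finite,linorder}^'m::{finite,linorder} \<Rightarrow> 'm \<Rightarrow> 'n \<Rightarrow> real" where
  "row_partial_sum X i j = (\<Sum>k\<le>j. X $ i $ k)"

definition sign_matrix :: "real^'n::{finite,linorder}^'m::{finite,linorder} \<Rightarrow> bool" where
  "sign_matrix X \<longleftrightarrow>
     (\<forall>i j. X $ i $ j \<in> {-1, 0, 1}) \<and>
     (\<forall>i j. col_partial_sum X i j \<in> {0, 1}) \<and>
     (\<forall>i j. row_partial_sum X i j \<ge> 0)"

text \<open>The prescribed sum \<open>a\<close> with index \<open>\<lambda>\<^sub>1 - i + 1\<close> of row \<open>i\<close>.\<close>

definition row_total :: "nat list \<Rightarrow> 'm::{finite,linorder} \<Rightarrow> nat" where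
  "row_total p i = count_list p (hd p - pos i + 1)"

definition sign_matrices ::
    "nat list \<Rightarrow> (real^'n::{finite,linorder}^'m::{finite,linorder}) set" where
  "sign_matrices p = {X. sign_matrix X \<and> (\<forall>i. (\<Sum>j\<in>UNIV. X $ i $ j) = real (row_total p i))}"

definition sign_polytope ::
    "nat list \<Rightarrow> (real^'n::{finite,linorder}^'m::{finite,linorder}) set" where
  "sign_polytope p = convex hull (sign_matrices p)"

text \<open>
  \<open>Vert i j\<close> is the edge \<open>(i,j)\<close>--\<open>(i+1,j)\<close> and \<open>Horiz i j\<close> the edge
  \<open>(i,j)\<close>--\<open>(i,j+1)\<close> of the grid graph. Its vertices are pairs of 1-based positions,
  up to \<open>CARD('m) + 1\<close> and \<open>CARD('n) + 1\<close>.
\<close>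

datatype ('m, 'n) edge = Vert 'm 'n | Horiz 'm 'n

fun edge_ends :: "('m::{finite,linorder}, 'n::{finite,linorder}) edge \<Rightarrow> (nat \<times> nat) \<times> (nat \<times> nat)"
where
  "edge_ends (Vert i j) = ((pos i, pos j), (pos i + 1, pos j))"
| "edge_ends (Horiz i j) = ((pos i, pos j), (pos i, pos j + 1))"

text \<open>
  \<open>Values\<close> occurs on vertical edges, \<open>Zero\<close> and \<open>Star\<close> on horizontal edges that are not
  final, \<open>Fixed\<close> on final horizontal edges, and \<open>Unlabeled\<close> only in the empty labeling.
\<close>

datatype label = Unlabeled | Values "real set" | Zero | Star | Fixed nat

type_synonym ('m, 'n) labeling = "('m, 'n) edge \<Rightarrow> label"

definition empty_labeling :: "('m, 'n) labeling" where
  "empty_labeling = (\<lambda>e. Unlabeled)"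

fun zero_dim_component ::
    "nat list \<Rightarrow> real^'n::{finite,linorder}^'m::{finite,linorder} \<Rightarrow> ('m, 'n) labeling" where
  "zero_dim_component p X (Vert i j) = Values {col_partial_sum X i j}"
| "zero_dim_component p X (Horiz i j) =
     (if pos j < CARD('n) then (if row_partial_sum X i j = 0 then Zero else Star)
      else Fixed (row_total p i))"

fun label_values :: "label \<Rightarrow> real set" where
  "label_values (Values A) = A"
| "label_values _ = {}"

definition union_labeling ::
    "nat list \<Rightarrow> ('m::{finite,linorder}, 'n::{finite,linorder}) labeling set \<Rightarrow> ('m, 'n) labeling"
where
  "union_labeling p D =
     (if D \<subseteq> {empty_labeling} then empty_labeling
      else (\<lambda>e. case e of
          Vert i j \<Rightarrow> Values (\<Union>d\<in>D. label_values (d e))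
        | Horiz i j \<Rightarrow>
            (if pos j < CARD('n) then (if \<exists>d\<in>D. d e = Star then Star else Zero)
             else Fixed (row_total p i))))"

definition grid_components ::
    "nat list \<Rightarrow> ('m::{finite,linorder}, 'n::{finite,linorder}) labeling set" where
  "grid_components p =
     insert empty_labeling
       {union_labeling p (zero_dim_component p ` S) | S.
          S \<noteq> {} \<and> S \<subseteq> (sign_matrices p :: (real^'n::{finite,linorder}^'m::{finite,linorder}) set)}"

fun label_le :: "label \<Rightarrow> label \<Rightarrow> bool" where
  "label_le Unlabeled _ = True"
| "label_le (Values A) (Values B) = (A \<subseteq> B)"
| "label_le Zero Zero = True"
| "label_le Zero Star = True"
| "label_le Star Star = True"
| "label_le (Fixed a) (Fixed b) = (a = b)"
| "label_le _ _ = False"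

definition labeling_le :: "('m, 'n) labeling \<Rightarrow> ('m, 'n) labeling \<Rightarrow> bool" where
  "labeling_le d d' \<longleftrightarrow> (\<forall>e. label_le (d e) (d' e))"

definition darkened :: "('m, 'n) labeling \<Rightarrow> ('m, 'n) edge set" where
  "darkened d = {Vert i j | i j. d (Vert i j) = Values {0, 1}} \<union> {Horiz i j | i j. d (Horiz i j) = Star}"

text \<open>
  The drawing of the darkened edges in the plane. An inner vertex \<open>(i,j)\<close> is drawn at
  abscissa \<open>j\<close> and ordinate \<open>-i\<close>. All boundary vertices are drawn at one common point,
  which lies below and to the right of the inner vertices; this makes the darkened edges that
  end at the boundary meet in the exterior region. The straight edges to that point cross neither
  each other nor the rest of the grid (final horizontal edges are never darkened), so this is a
  planar drawing.
\<close>

definition vertex_point :: "nat \<Rightarrow> nat \<Rightarrow> nat \<times> nat \<Rightarrow> real \<times> real" where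
  "vertex_point m n = (\<lambda>(i, j).
     if i = m + 1 \<or> j = n + 1 then (real (n + 1), - real (m + 1)) else (real j, - real i))"

definition drawing :: "('m::{finite,linorder}, 'n::{finite,linorder}) labeling \<Rightarrow> (real \<times> real) set" where
  "drawing d = (\<Union>e\<in>darkened d.
     closed_segment (vertex_point CARD('m) CARD('n) (fst (edge_ends e)))
                    (vertex_point CARD('m) CARD('n) (snd (edge_ends e))))"

text \<open>The bounded faces of a plane graph are the bounded components of the complement of its drawing.\<close>

definition regions :: "('m::{finite,linorder}, 'n::{finite,linorder}) labeling \<Rightarrow> int" where
  "regions d =
     (if d = empty_labeling then -1
      else int (card {C \<in> components (- drawing d). bounded C}))"

definition psi ::
    "nat list \<Rightarrow> (real^'n::{finite,linorder}^'m::{finite,linorder}) set \<Rightarrow> ('m, 'n) labeling" where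
  "psi p F = union_labeling p (zero_dim_component p ` {X \<in> sign_matrices p. X extreme_point_of F})"

end

theory Submission
  imports Defs
begin

text \<open>
  Describe a matrix by its corner sums \<open>H(s,t)\<close>, the sums over the first \<open>s\<close> rows and \<open>t\<close> columns.
  The partial sums are first differences of \<open>H\<close>: \<open>c\<^sub>i\<^sub>j = H(i,j) - H(i,j-1)\<close> and
  \<open>r\<^sub>i\<^sub>j = H(i,j) - H(i-1,j)\<close>. Hence the polytope of all matrices with \<open>0 \<le> c\<^sub>i\<^sub>j \<le> 1\<close>,
  \<open>0 \<le> r\<^sub>i\<^sub>j\<close> and the prescribed row sums has integral vertices: shifting all corner sums of one
  nonzero class modulo 1 preserves every inequality that is attained. So this polytope is
  \<open>P(\<lambda>,n)\<close>, and a component records exactly which of its inequalities are attained by all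
  matrices of a face; this gives the isomorphism of posets.

  For the dimension, view \<open>H\<close> as a height function on the cells of the drawn grid. The direction
  space of a face consists of the height functions that are constant across undarkened edges and
  vanish outside, that is, of the locally constant functions on the complement of the drawing that
  vanish on its unbounded component.
\<close>

section \<open>Cells of the drawn grid\<close>

text \<open>Regions are topological components of a complement, yet neither the Jordan curve theorem
  nor Euler's formula enters: the bounded faces are counted as the dimension of a function space.
  This takes two facts. Cells on the two sides of an undarkened edge lie in one component, and a
  function on cells that is constant across undarkened edges is constant on every component. The
  obstacle is the common boundary point. All vertical edges of the last row run into it, so every
  cell of that row touches it together with the half plane below, and if it is not covered by a
  drawn edge it joins cells that are not neighbours. Heights still agree there, because then no
  vertical edge of the last row is darkened. On the polyhedral side, a component may come from any
  nonempty set of sign matrices, not only from the vertex set of a face. Passing to the smallest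
  face through the set leaves all labels unchanged. Relative interior points are the tool for faces
  and for directions: at such a point an inequality is attained only if it is attained on the whole
  face.\<close>

locale grid_drawing =
  fixes m n :: nat and dv dh :: "nat \<Rightarrow> nat \<Rightarrow> bool"
  assumes m_pos: "0 < m"
begin

text \<open>
  The abscissa at ordinate \<open>y\<close> of the line through the vertical edge \<open>(i,j)\<close>. The edges of the
  last row slant to the common boundary point, so there \<open>line\<close> is increasing in \<open>j\<close> only above
  that point.
\<close>

definition line :: "nat \<Rightarrow> nat \<Rightarrow> real \<Rightarrow> real" where
  "line i j y = real j + (if i = m then (- real m - y) * (real n + 1 - real j) else 0)"

definition vseg :: "nat \<Rightarrow> nat \<Rightarrow> (real \<times> real) set" where
  "vseg i j = {(x, y). - real i - 1 \<le> y \<and> y \<le> - real i \<and> x = line i j y}"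

definition hseg :: "nat \<Rightarrow> nat \<Rightarrow> (real \<times> real) set" where
  "hseg i j = {(x, y). y = - real i \<and> real j \<le> x \<and> x \<le> real j + 1}"

definition drawn :: "(real \<times> real) set" where
  "drawn = (\<Union>i\<in>{1..m}. \<Union>j\<in>{1..n}. (if dv i j then vseg i j else {})) \<union>
           (\<Union>i\<in>{1..m}. \<Union>j\<in>{1..<n}. (if dh i j then hseg i j else {}))"

text \<open>
  The cell \<open>(i,j)\<close> lies below row \<open>i\<close> and to the right of column \<open>j\<close>. The cells with \<open>i = 0\<close> and
  \<open>i = m + 1\<close> are half planes, independent of \<open>j\<close>; those with \<open>j = 0\<close> or \<open>j = n\<close> are half strips.
\<close>

definition cell :: "nat \<Rightarrow> nat \<Rightarrow> (real \<times> real) set" where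
  "cell i j = {(x, y). (1 \<le> i \<longrightarrow> y \<le> - real i) \<and> (i \<le> m \<longrightarrow> - real i - 1 \<le> y) \<and>
     (1 \<le> i \<and> i \<le> m \<and> 1 \<le> j \<longrightarrow> line i j y \<le> x) \<and>
     (1 \<le> i \<and> i \<le> m \<and> j < n \<longrightarrow> x \<le> line i (Suc j) y)}"

definition open_cell :: "nat \<Rightarrow> nat \<Rightarrow> (real \<times> real) set" where
  "open_cell i j = {(x, y). (1 \<le> i \<longrightarrow> y < - real i) \<and> (i \<le> m \<longrightarrow> - real i - 1 < y) \<and>
     (1 \<le> i \<and> i \<le> m \<and> 1 \<le> j \<longrightarrow> line i j y < x) \<and>
     (1 \<le> i \<and> i \<le> m \<and> j < n \<longrightarrow> x < line i (Suc j) y)}"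

text \<open>In the last row the lines are \<open>1/2\<close> apart at half height, in the other rows
  \<open>1\<close>. The offset \<open>1/4\<close> therefore keeps the point strictly between
  neighbouring lines in every row.\<close>

definition inner_point :: "nat \<Rightarrow> nat \<Rightarrow> real \<times> real" where
  "inner_point i j = (line i j (- real i - 1/2) + 1/4, - real i - 1/2)"

lemma line_mono:
  assumes "j \<le> k" and "i = m \<Longrightarrow> - real m - 1 \<le> y"
  shows "line i j y \<le> line i k y"
proof -
  have "line i k y - line i j y = (real k - real j) * (if i = m then y + real m + 1 else 1)"
    by (auto simp: line_def algebra_simps)
  also have "\<dots> \<ge> 0" using assms by (intro mult_nonneg_nonneg) auto
  finally show ?thesis by simp
qed

lemma line_combination:
  "line i j ((1 - t) * y + t * y') = (1 - t) * line i j y + t * line i j y'"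
  by (auto simp: line_def algebra_simps)

lemma line_at_row: "k \<le> i \<Longrightarrow> i \<le> Suc k \<Longrightarrow> i \<le> m \<Longrightarrow> line k j (- real i) = real j"
  by (auto simp: line_def)

lemma vseg_subset_drawn:
  "\<lbrakk>dv i j; 1 \<le> i; i \<le> m; 1 \<le> j; j \<le> n\<rbrakk> \<Longrightarrow> vseg i j \<subseteq> drawn"
  unfolding drawn_def by fastforce

lemma hseg_subset_drawn:
  "\<lbrakk>dh i j; 1 \<le> i; i \<le> m; 1 \<le> j; j < n\<rbrakk> \<Longrightarrow> hseg i j \<subseteq> drawn"
  unfolding drawn_def by fastforce

lemma drawnE:
  assumes "z \<in> drawn"
  obtains (vertical) i j where "dv i j" "1 \<le> i" "i \<le> m" "1 \<le> j" "j \<le> n" "z \<in> vseg i j"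
  | (horizontal) i j where "dh i j" "1 \<le> i" "i \<le> m" "1 \<le> j" "j < n" "z \<in> hseg i j"
  using assms unfolding drawn_def by (auto split: if_splits)

lemma strip_eq:
  assumes "- real i - 1 < y" "y < - real i" "- real k - 1 \<le> y" "y \<le> - real k"
  shows "i = k"
proof -
  have "real i < real k + 1" "real k < real i + 1" using assms by auto
  thus ?thesis by linarith
qed

section \<open>Open cells and paths between neighbouring cells\<close>

lemma open_cell_disjoint_drawn:
  assumes "i \<le> Suc m"
  shows "open_cell i j \<inter> drawn = {}"
proof -
  have False if z: "(x, y) \<in> open_cell i j" "(x, y) \<in> drawn" for x y
    using z(2)
  proof (cases rule: drawnE)
    case (vertical k l)
    hence y: "- real k - 1 \<le> y" "y \<le> - real k" "x = line k l y" by (auto simp: vseg_def)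
    have i: "1 \<le> i" using z(1) y vertical by (cases i) (auto simp: open_cell_def)
    have i': "i \<le> m"
    proof (rule ccontr)
      assume "\<not> i \<le> m"
      hence "i = Suc m" using assms by simp
      hence "y < - real m - 1" using z(1) by (auto simp: open_cell_def)
      thus False using y vertical by linarith
    qed
    have st: "- real i - 1 < y" "y < - real i" using z(1) i i' by (auto simp: open_cell_def)
    have ki: "i = k" using strip_eq[OF st y(1,2)] .
    have my: "- real m - 1 \<le> y" using st i' by linarith
    show False
    proof (cases "l \<le> j")
      case True
      hence "line i j y < x" using z(1) i i' vertical by (auto simp: open_cell_def)
      thus False using line_mono[OF True, of i y] my y ki by simp
    next
      case False
      hence "Suc j \<le> l" "j < n" using vertical by auto
      hence "x < line i (Suc j) y" using z(1) i i' by (auto simp: open_cell_def)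
      thus False using line_mono[OF \<open>Suc j \<le> l\<close>, of i y] my y ki by simp
    qed
  next
    case (horizontal k l)
    hence y: "y = - real k" by (auto simp: hseg_def)
    have "1 \<le> i" using z(1) y horizontal by (cases i) (auto simp: open_cell_def)
    hence "y < - real i" using z(1) by (auto simp: open_cell_def)
    hence "i < k" using y by simp
    hence "i \<le> m" using horizontal by simp
    hence "- real i - 1 < y" using z(1) by (auto simp: open_cell_def)
    thus False using y \<open>i < k\<close> by linarith
  qed
  thus ?thesis by auto
qed

lemma inner_point_in_open_cell: "i \<le> Suc m \<Longrightarrow> inner_point i j \<in> open_cell i j"
  by (auto simp: inner_point_def open_cell_def line_def field_simps)

lemma inner_point_notin_drawn: "i \<le> Suc m \<Longrightarrow> inner_point i j \<in> - drawn"
  using inner_point_in_open_cell open_cell_disjoint_drawn by fastforce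

lemma convex_combination_less:
  fixes a b c d t :: real
  assumes "a \<le> b" "c < d" "0 < t" "t \<le> 1"
  shows "(1 - t) * a + t * c < (1 - t) * b + t * d"
  using assms by (intro add_le_less_mono mult_left_mono mult_strict_left_mono) auto

lemma combination_in_open_cell:
  assumes "(x, y) \<in> cell i j" "(x', y') \<in> open_cell i j" "0 < t" "t \<le> 1"
  shows "((1 - t) * x + t * x', (1 - t) * y + t * y') \<in> open_cell i j"
proof -
  note less = convex_combination_less[OF _ _ assms(3,4)]
  have 1: "(1 - t) * y + t * y' < - real i" if "1 \<le> i"
    using less[of y "- real i" y' "- real i"] assms that
    by (auto simp: cell_def open_cell_def algebra_simps)
  have 2: "- real i - 1 < (1 - t) * y + t * y'" if "i \<le> m"
    using less[of "- real i - 1" y "- real i - 1" y'] assms that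
    by (auto simp: cell_def open_cell_def algebra_simps)
  have 3: "line i j ((1 - t) * y + t * y') < (1 - t) * x + t * x'" if "1 \<le> i" "i \<le> m" "1 \<le> j"
    unfolding line_combination
    using less[of "line i j y" x "line i j y'" x'] assms that
    by (auto simp: cell_def open_cell_def)
  have 4: "(1 - t) * x + t * x' < line i (Suc j) ((1 - t) * y + t * y')" if "1 \<le> i" "i \<le> m" "j < n"
    unfolding line_combination
    using less[of x "line i (Suc j) y" x' "line i (Suc j) y'"] assms that
    by (auto simp: cell_def open_cell_def)
  show ?thesis using 1 2 3 4 by (auto simp: open_cell_def)
qed

text \<open>A cell is cut out by affine inequalities that are strict at the inner point. On the
  segment towards it they become strict at once, so the segment can meet the drawing only at its
  start.\<close>

lemma connected_component_inner_point:
  assumes "z \<in> cell i j" "z \<notin> drawn" "i \<le> Suc m"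
  shows "connected_component (- drawn) z (inner_point i j)"
proof -
  let ?c = "inner_point i j"
  have "closed_segment z ?c \<subseteq> - drawn"
  proof
    fix w assume "w \<in> closed_segment z ?c"
    then obtain t where t: "0 \<le> t" "t \<le> 1" and w: "w = (1 - t) *\<^sub>R z + t *\<^sub>R ?c"
      by (auto simp: in_segment)
    show "w \<in> - drawn"
    proof (cases "t = 0")
      case True thus ?thesis using w assms by simp
    next
      case False
      obtain x y x' y' where zc: "z = (x, y)" "?c = (x', y')" by (metis surj_pair)
      have "w = ((1 - t) * x + t * x', (1 - t) * y + t * y')" using w zc by simp
      hence "w \<in> open_cell i j"
        using combination_in_open_cell[of x y i j x' y' t] assms t False zc
          inner_point_in_open_cell[of i j] by simp
      thus ?thesis using open_cell_disjoint_drawn[OF assms(3), of j] by blast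
    qed
  qed
  thus ?thesis unfolding connected_component_def
    by (intro exI[of _ "closed_segment z ?c"]) auto
qed

lemma connected_component_across_vertical:
  assumes "\<not> dv i j" "1 \<le> i" "i \<le> m" "1 \<le> j" "j \<le> n"
  shows "connected_component (- drawn) (inner_point i (j - 1)) (inner_point i j)"
proof -
  \<comment> \<open>The midpoint of the edge: at half height even the slanted lines of the last row
    are distinct, and no horizontal edge has a half-integral ordinate. Only the edge
    \<open>(i,j)\<close> itself could cover it.\<close>
  define y where "y = - real i - 1/2"
  define z where "z = (line i j y, y)"
  have strict: "k < l \<Longrightarrow> line i k y < line i l y" for k l
    by (auto simp: line_def y_def field_simps)
  have "z \<notin> drawn"
  proof
    assume "z \<in> drawn"
    thus False
    proof (cases rule: drawnE)
      case (vertical k l)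
      hence "i = k" by (intro strip_eq[of i y k]) (auto simp: z_def y_def vseg_def)
      hence "line i j y = line i l y" using vertical by (auto simp: z_def vseg_def)
      hence "j = l" using strict[of j l] strict[of l j] by (cases j l rule: linorder_cases) auto
      thus False using vertical assms \<open>i = k\<close> by simp
    next
      case (horizontal k l)
      hence "real k = real i + 1/2" by (auto simp: hseg_def z_def y_def)
      hence "real (2 * k) = real (2 * i + 1)" by simp
      hence "2 * k = 2 * i + 1" by (simp only: of_nat_eq_iff)
      thus False by presburger
    qed
  qed
  moreover have "z \<in> cell i (j - 1)" "z \<in> cell i j"
    using assms line_mono[of "j - 1" j i y] line_mono[of j "Suc j" i y]
    by (auto simp: cell_def z_def y_def)
  ultimately show ?thesis
    using connected_component_inner_point assms
    by (meson connected_component_sym connected_component_trans le_SucI)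
qed

lemma connected_component_across_horizontal:
  assumes "\<not> dh i j" "1 \<le> i" "i \<le> m" "1 \<le> j" "j < n"
  shows "connected_component (- drawn) (inner_point (i - 1) j) (inner_point i j)"
proof -
  \<comment> \<open>The midpoint of the edge: at the ordinate \<open>- real i\<close> all vertical
    edges have integral abscissae, so again only the edge itself could cover it.\<close>
  define z where "z = (real j + 1/2, - real i)"
  have half: "real j + 1/2 \<noteq> real l" for l :: nat
  proof
    assume "real j + 1/2 = real l"
    hence "real (2 * j + 1) = real (2 * l)" by simp
    hence "2 * j + 1 = 2 * l" by (simp only: of_nat_eq_iff)
    thus False by presburger
  qed
  have "z \<notin> drawn"
  proof
    assume "z \<in> drawn"
    thus False
    proof (cases rule: drawnE)
      case (vertical k l)
      hence "k \<le> i" "i \<le> Suc k" by (auto simp: z_def vseg_def)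
      thus False using vertical half[of l] line_at_row[of k i l] assms by (auto simp: z_def vseg_def)
    next
      case (horizontal k l)
      hence "k = i" "real l \<le> real j + 1/2" "real j + 1/2 \<le> real l + 1"
        by (auto simp: z_def hseg_def)
      hence "l = j" using half[of l] half[of "Suc l"] by simp
      thus False using horizontal assms \<open>k = i\<close> by simp
    qed
  qed
  moreover have "z \<in> cell (i - 1) j" "z \<in> cell i j"
    using assms line_at_row[of "i - 1" i] line_at_row[of i i]
    by (auto simp: cell_def z_def of_nat_diff)
  ultimately show ?thesis
    using connected_component_inner_point[of z "i - 1" j] connected_component_inner_point[of z i j] assms
    by (meson connected_component_sym connected_component_trans diff_le_self le_SucI le_trans)
qed

section \<open>Unbounded components and exterior cells\<close>

lemma unbounded_component_of_ray:
  fixes S :: "(real \<times> real) set"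
  assumes "\<And>t. 0 \<le> t \<Longrightarrow> a + t *\<^sub>R w \<in> S" "w \<noteq> 0"
  shows "\<not> bounded (connected_component_set S a)"
proof
  let ?R = "(\<lambda>t. a + t *\<^sub>R w) ` {0..}"
  assume "bounded (connected_component_set S a)"
  moreover have "?R \<subseteq> connected_component_set S a"
  proof (rule connected_component_maximal)
    show "a \<in> ?R" by (rule image_eqI[of _ _ 0]) auto
    show "connected ?R"
      by (intro connected_continuous_image continuous_intros convex_connected) auto
    show "?R \<subseteq> S" using assms by auto
  qed
  ultimately have "bounded ?R" by (rule bounded_subset)
  then obtain B where B: "\<And>t. 0 \<le> t \<Longrightarrow> norm (a + t *\<^sub>R w) \<le> B"
    unfolding bounded_iff by auto
  \<comment> \<open>With this parameter the step has norm \<open>B + norm a + 1\<close>, one more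
    than the triangle inequality allows.\<close>
  define t where "t = (B + norm a + 1) / norm w"
  have "0 \<le> B" using B[of 0] order_trans[OF norm_ge_zero] by fastforce
  hence t: "0 \<le> t" by (simp add: t_def)
  have "norm (t *\<^sub>R w) = B + norm a + 1"
    using assms(2) \<open>0 \<le> B\<close> by (simp add: t_def)
  moreover have "norm (t *\<^sub>R w) \<le> norm (a + t *\<^sub>R w) + norm a"
    using norm_triangle_ineq4[of "a + t *\<^sub>R w" a] by simp
  ultimately show False using B[OF t] by simp
qed

definition exterior :: "nat \<Rightarrow> nat \<Rightarrow> bool" where
  "exterior i j \<longleftrightarrow> i = 0 \<or> i = Suc m \<or> j = 0 \<or> j = n"

lemma exterior_unbounded:
  assumes "exterior i j" "i \<le> Suc m" 
  shows "\<not> bounded (connected_component_set (- drawn) (inner_point i j))"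
proof -
  let ?x = "line i j (- real i - 1/2) + 1/4" and ?y = "- real i - 1/2"
  have o: "(?x, ?y) \<in> open_cell i j"
    using inner_point_in_open_cell[OF assms(2), of j] by (simp add: inner_point_def)
  have "\<exists>w. w \<noteq> 0 \<and> (\<forall>t\<ge>0. (?x, ?y) + t *\<^sub>R w \<in> open_cell i j)"
  proof -
    consider "i = 0" | "i = Suc m" | "1 \<le> i" "i \<le> m" "j = 0" | "1 \<le> i" "i \<le> m" "j = n"
      using assms by (force simp: exterior_def)
    thus ?thesis
    proof cases
      case 1 thus ?thesis using o by (intro exI[of _ "(0, 1)"]) (auto simp: open_cell_def zero_prod_def)
    next
      case 2 thus ?thesis using o by (intro exI[of _ "(0, -1)"]) (auto simp: open_cell_def zero_prod_def)
    next
      case 3 thus ?thesis using o by (intro exI[of _ "(-1, 0)"]) (auto simp: open_cell_def zero_prod_def)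
    next
      case 4 thus ?thesis using o by (intro exI[of _ "(1, 0)"]) (auto simp: open_cell_def zero_prod_def)
    qed
  qed
  then obtain w where "w \<noteq> 0" "\<And>t. 0 \<le> t \<Longrightarrow> inner_point i j + t *\<^sub>R w \<in> open_cell i j"
    by (auto simp: inner_point_def)
  thus ?thesis
    using open_cell_disjoint_drawn[OF assms(2), of j] by (intro unbounded_component_of_ray[of _ w]) blast+
qed

lemma cells_cover: "\<exists>i\<le>Suc m. \<exists>j\<le>n. z \<in> cell i j"
proof -
  obtain x y where z: "z = (x, y)" by (metis surj_pair)
  consider "-1 \<le> y" | "y \<le> - real m - 1" | "y < -1" "- real m - 1 < y" by linarith
  thus ?thesis
  proof cases
    case 1 thus ?thesis by (intro exI[of _ 0] exI[of _ 0] conjI) (auto simp: cell_def z)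
  next
    case 2
    thus ?thesis by (intro exI[of _ "Suc m"] conjI exI[of _ 0]) (auto simp: cell_def z)
  next
    case 3
    define i where "i = nat \<lfloor>- y\<rfloor>"
    have "real i = of_int \<lfloor>- y\<rfloor>" using 3 by (simp add: i_def)
    hence i: "real i \<le> - y" "- y < real i + 1" by linarith+
    hence "real i < real m + 1" "real i > 0" using 3 by linarith+
    hence im: "1 \<le> i" "i \<le> m" by linarith+
    \<comment> \<open>The column is found as the last line that is not to the right of the point;
      \<open>j = 0\<close> qualifies vacuously, so a maximum exists.\<close>
    let ?J = "{j. j \<le> n \<and> (1 \<le> j \<longrightarrow> line i j y \<le> x)}"
    have J: "finite ?J" "?J \<noteq> {}" by (auto intro!: exI[of _ 0])
    define j where "j = Max ?J"
    have j: "j \<in> ?J" using Max_in[OF J] by (simp add: j_def)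
    have "x \<le> line i (Suc j) y" if "j < n"
    proof (rule ccontr)
      assume "\<not> x \<le> line i (Suc j) y"
      hence "Suc j \<in> ?J" using that by auto
      hence "Suc j \<le> j" unfolding j_def using J(1) by (intro Max_ge)
      thus False by simp
    qed
    hence "z \<in> cell i j" using j i im by (auto simp: cell_def z)
    thus ?thesis using j im by (intro exI[of _ i] exI[of _ j] conjI) auto
  qed
qed

text \<open>The point reaches the inner point of any cell that contains it, and an exterior cell
  would make the component unbounded. Hence bounded faces are named by cells, which also shows that
  there are finitely many.\<close>

lemma bounded_component_has_inner_point:
  assumes "z \<notin> drawn" "bounded (connected_component_set (- drawn) z)"
  shows "\<exists>i j. 1 \<le> i \<and> i \<le> m \<and> 1 \<le> j \<and> j < n \<and> connected_component (- drawn) z (inner_point i j)"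
proof -
  obtain i j where ij: "i \<le> Suc m" "j \<le> n" "z \<in> cell i j" using cells_cover by blast
  have c: "connected_component (- drawn) z (inner_point i j)"
    using connected_component_inner_point assms ij by blast
  hence "connected_component_set (- drawn) z = connected_component_set (- drawn) (inner_point i j)"
    by (simp add: connected_component_eq)
  hence "\<not> exterior i j" using exterior_unbounded ij assms by metis
  thus ?thesis using c ij by (intro exI[of _ i] exI[of _ j]) (auto simp: exterior_def)
qed

section \<open>Heights are constant on components of the complement\<close>

definition height :: "(nat \<Rightarrow> nat \<Rightarrow> real) \<Rightarrow> bool" where
  "height H \<longleftrightarrow> (\<forall>i j. exterior i j \<longrightarrow> H i j = 0) \<and>
     (\<forall>i\<in>{1..m}. \<forall>j\<in>{1..n}. \<not> dv i j \<longrightarrow> H i (j - 1) = H i j) \<and>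
     (\<forall>i\<in>{1..m}. \<forall>j\<in>{1..<n}. \<not> dh i j \<longrightarrow> H (i - 1) j = H i j)"

lemma height_exterior: "height H \<Longrightarrow> exterior i j \<Longrightarrow> H i j = 0"
  by (auto simp: height_def)

lemma height_vertical:
  "\<lbrakk>height H; 1 \<le> i; i \<le> m; 1 \<le> j; j \<le> n; \<not> dv i j\<rbrakk> \<Longrightarrow> H i (j - 1) = H i j"
  unfolding height_def by (meson atLeastAtMost_iff)

text \<open>All lines between the two cells are squeezed to the abscissa of \<open>z\<close>, so
  each of their edges passes through \<open>z\<close> and none is darkened. More than one line can
  be involved only at the common boundary point.\<close>

lemma height_row:
  assumes H: "height H" and z: "z \<notin> drawn" and i: "1 \<le> i" "i \<le> m"
    and "z \<in> cell i j" "z \<in> cell i k" "j \<le> k" "k \<le> n"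
  shows "H i j = H i k"
proof -
  obtain x y where xy: "z = (x, y)" by (metis surj_pair)
  have y: "- real i - 1 \<le> y" "y \<le> - real i" using assms by (auto simp: xy cell_def)
  have my: "- real m - 1 \<le> y" using y i by linarith
  have "H i j = H i l" if "j \<le> l" "l \<le> k" for l
    using that
  proof (induction l rule: dec_induct)
    case (step l)
    have "x \<le> line i (Suc j) y" "line i k y \<le> x" using assms step by (auto simp: xy cell_def)
    hence "x = line i (Suc l) y"
      using line_mono[of "Suc j" "Suc l" i y] line_mono[of "Suc l" k i y] step my by simp
    hence "z \<in> vseg i (Suc l)" using y by (simp add: vseg_def xy)
    hence "\<not> dv i (Suc l)" using vseg_subset_drawn[of i "Suc l"] z i step assms by auto
    hence "H i (Suc l - 1) = H i (Suc l)"
      using height_vertical[OF H i, of "Suc l"] step assms(8) by simp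
    thus ?case using step by simp
  qed simp
  thus ?thesis using assms by blast
qed

lemma height_column:
  assumes H: "height H" and z: "(x, - real i) \<notin> drawn" and i: "1 \<le> i" "i \<le> m"
    and "(x, - real i) \<in> cell i j" "j \<le> n"
  shows "H (i - 1) j = H i j"
proof (cases "exterior 1 j")
  case True
  hence "exterior (i - 1) j" "exterior i j" using m_pos by (auto simp: exterior_def)
  thus ?thesis by (simp add: height_exterior[OF H])
next
  case False
  hence j: "1 \<le> j" "j < n" using assms by (auto simp: exterior_def)
  have "(x, - real i) \<in> hseg i j"
    using assms j line_at_row[of i i] by (auto simp: cell_def hseg_def)
  hence "\<not> dh i j" using hseg_subset_drawn[of i j] z i j by auto
  thus ?thesis using H i j unfolding height_def by auto
qed

lemma cell_shared_row:
  assumes "(x, - real (Suc i)) \<in> cell i j" "1 \<le> i" "Suc i \<le> m"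
  shows "(x, - real (Suc i)) \<in> cell (Suc i) j"
  using assms line_at_row[of i "Suc i"] line_at_row[of "Suc i" "Suc i"]
  by (auto simp: cell_def simp del: of_nat_Suc)

text \<open>Closed cells overlap along edges and at vertices. This lemma makes the height a
  well-defined function of a point off the drawing. Two cells meet either within a row or, in
  consecutive rows, at the ordinate between them.\<close>

lemma height_unique:
  assumes H: "height H" and z: "z \<notin> drawn"
    and ij: "z \<in> cell i j" "i \<le> Suc m" "j \<le> n" and kl: "z \<in> cell k l" "k \<le> Suc m" "l \<le> n"
  shows "H i j = H k l"
proof -
  have main: "H i j = H k l" if ik: "i \<le> k"
    and ij: "z \<in> cell i j" "i \<le> Suc m" "j \<le> n" and kl: "z \<in> cell k l" "k \<le> Suc m" "l \<le> n"
  for i j k l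
  proof -
    obtain x y where xy: "z = (x, y)" by (metis surj_pair)
    have same: "H i j = H i l" if "1 \<le> i" "i \<le> m" "z \<in> cell i j" "z \<in> cell i l" "j \<le> n" "l \<le> n" for i j l
      using height_row[OF H z that(1-4)] height_row[OF H z that(1,2,4,3)] that(5,6) by linarith
    have ext: "H 0 j = 0" "H (Suc m) j = 0" for j
      by (simp_all add: height_exterior[OF H] exterior_def)
    consider "i = k" | "i < k" by (use ik in linarith)
    thus ?thesis
    proof cases
      case 1
      have "i = 0 \<or> 1 \<le> i \<and> i \<le> m \<or> i = Suc m" using ij by auto
      thus ?thesis using same[of i j l] ext[of j] ext[of l] ij kl 1 by metis
    next
      case 2
      hence "y \<le> - real k" "- real i - 1 \<le> y" using ij kl by (auto simp: cell_def xy)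
      hence k: "k = Suc i" and y: "y = - real (Suc i)" using 2 by auto
      show ?thesis
      proof (cases "k \<le> m")
        case True
        have "H i l = H k l"
          using height_column[OF H, of x k l] True z kl k y by (simp add: xy)
        moreover have "H i j = H i l" 
        proof (cases "i = 0")
          case False
          have "z \<in> cell k j" using cell_shared_row[of x i j] ij True False k y by (simp add: xy)
          hence "H k j = H k l" using same[of k j l] kl ij True k by simp
          moreover have "H i j = H k j"
            using height_column[OF H, of x k j] True z \<open>z \<in> cell k j\<close> ij k y by (simp add: xy)
          ultimately show ?thesis using \<open>H i l = H k l\<close> by simp
        qed (simp add: ext)
        ultimately show ?thesis by simp
      next
        case False
        hence i: "i = m" and k: "k = Suc m" using k 2 kl by auto
        have "H m j = 0"
        proof (cases "j = 0 \<or> j = n")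
          case True thus ?thesis by (auto intro!: height_exterior[OF H] simp: exterior_def)
        next
          case False
          \<comment> \<open>At its bottom a cell of the last row between two lines shrinks to the
            common boundary point. That point also belongs to the exterior cell
            \<open>(m, 0)\<close>, so comparison within the row gives height
            \<open>0\<close>.\<close>
          hence "x = real n + 1"
            using ij m_pos i y by (auto simp: cell_def xy line_def)
          hence "z \<in> cell m 0" using m_pos i y by (auto simp: cell_def xy line_def)
          hence "H m j = H m 0" using same[of m j 0] m_pos ij i by simp
          also have "\<dots> = 0" by (rule height_exterior[OF H]) (simp add: exterior_def)
          finally show ?thesis .
        qed
        thus ?thesis using ext i k by simp
      qed
    qed
  qed
  show ?thesis
  proof (cases "i \<le> k")
    case True thus ?thesis using main ij kl by blast
  next
    case False thus ?thesis using main[of k i l j] ij kl by simp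
  qed
qed

lemma closed_cell: "closed (cell i j)"
proof -
  have lin: "continuous_on UNIV (\<lambda>z::real\<times>real. line i j (snd z))" for i j
    unfolding line_def by (cases "i = m") (auto intro!: continuous_intros)
  have eq: "cell i j = {z. 1 \<le> i \<longrightarrow> snd z \<le> - real i} \<inter> {z. i \<le> m \<longrightarrow> - real i - 1 \<le> snd z} \<inter>
    {z. 1 \<le> i \<and> i \<le> m \<and> 1 \<le> j \<longrightarrow> line i j (snd z) \<le> fst z} \<inter>
    {z. 1 \<le> i \<and> i \<le> m \<and> j < n \<longrightarrow> fst z \<le> line i (Suc j) (snd z)}"
    by (auto simp: cell_def)
  show ?thesis unfolding eq
    by (intro closed_Int closed_Collect_imp closed_Collect_le lin open_Collect_const continuous_intros)
qed

text \<open>Cells are closed and finite in number, so the cells of one height and all other cells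
  form two closed sets. They cover the plane and by \<open>height_unique\<close> meet only on the
  drawing; a connected set off the drawing lies in one of them.\<close>

lemma component_in_level_cells:
  assumes H: "height H" and ij: "i \<le> Suc m" "j \<le> n"
    and z: "connected_component (- drawn) (inner_point i j) z"
  shows "\<exists>k\<le>Suc m. \<exists>l\<le>n. z \<in> cell k l \<and> H k l = H i j"
proof -
  define A where "A = (\<Union>(k, l) \<in> {(k, l). k \<le> Suc m \<and> l \<le> n \<and> H k l = H i j}. cell k l)"
  define B where "B = (\<Union>(k, l) \<in> {(k, l). k \<le> Suc m \<and> l \<le> n \<and> H k l \<noteq> H i j}. cell k l)"
  define C where "C = connected_component_set (- drawn) (inner_point i j)"
  have A: "w \<in> A \<longleftrightarrow> (\<exists>k\<le>Suc m. \<exists>l\<le>n. w \<in> cell k l \<and> H k l = H i j)" for w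
    unfolding A_def by blast
  have B: "w \<in> B \<longleftrightarrow> (\<exists>k\<le>Suc m. \<exists>l\<le>n. w \<in> cell k l \<and> H k l \<noteq> H i j)" for w
    unfolding B_def by blast
  have C: "w \<notin> drawn" if "w \<in> C" for w
    using that connected_component_in[of "- drawn" _ w] by (simp add: C_def)
  have fin: "finite {(k, l). k \<le> Suc m \<and> l \<le> n \<and> Q k l}" for Q
    by (rule finite_subset[of _ "{..Suc m} \<times> {..n}"]) auto
  have closed: "closed A" "closed B"
    unfolding A_def B_def by (intro closed_UN fin; auto intro: closed_cell)+
  have cover: "w \<in> A \<union> B" for w
    unfolding Un_iff A B using cells_cover[of w] by blast
  have "A \<inter> B \<inter> C = {}"
  proof (rule equals0I)
    fix w assume w: "w \<in> A \<inter> B \<inter> C"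
    then obtain k l where kl: "k \<le> Suc m" "l \<le> n" "w \<in> cell k l" "H k l = H i j"
      unfolding Int_iff A by blast
    obtain k' l' where kl': "k' \<le> Suc m" "l' \<le> n" "w \<in> cell k' l'" "H k' l' \<noteq> H i j"
      using w unfolding Int_iff B by blast
    have "H k l = H k' l'" using w by (intro height_unique[OF H C kl(3,1,2) kl'(3,1,2)]) simp
    thus False using kl kl' by simp
  qed
  moreover have "connected C" by (simp add: C_def)
  moreover have "C \<subseteq> A \<union> B" using cover by blast
  ultimately have disj: "A \<inter> C = {} \<or> B \<inter> C = {}"
    using closed by (intro connected_closedD)
  have "inner_point i j \<in> cell i j"
    using inner_point_in_open_cell[of i j] ij by (auto simp: open_cell_def cell_def)
  hence "inner_point i j \<in> A" unfolding A using ij by blast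
  moreover have "inner_point i j \<in> C"
    using inner_point_notin_drawn[of i j] ij by (simp add: C_def connected_component_refl_eq)
  ultimately have "B \<inter> C = {}" using disj by blast
  moreover have "z \<in> C" using z by (simp add: C_def)
  ultimately have "z \<in> A" using cover by blast
  thus ?thesis unfolding A .
qed

lemma height_component:
  assumes H: "height H" and "i \<le> Suc m" "j \<le> n" "k \<le> Suc m" "l \<le> n"
    and "connected_component (- drawn) (inner_point i j) (inner_point k l)"
  shows "H i j = H k l"
proof -
  obtain k' l' where "k' \<le> Suc m" "l' \<le> n" "inner_point k l \<in> cell k' l'" "H k' l' = H i j"
    using component_in_level_cells assms by blast
  moreover have "inner_point k l \<in> cell k l"
    using inner_point_in_open_cell[of k l] assms by (auto simp: open_cell_def cell_def)
  ultimately show ?thesis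
    using height_unique[OF H, of "inner_point k l" k l k' l'] inner_point_notin_drawn[of k l] assms by simp
qed

lemma bounded_inner_cell:
  assumes "i \<le> Suc m" "j \<le> n" "\<not> exterior i j"
  shows "cell i j \<subseteq> {0..real n + 1} \<times> {- real m - 1..0}"
proof -
  have ij: "1 \<le> i" "i \<le> m" "1 \<le> j" "j < n" using assms by (auto simp: exterior_def)
  have "0 \<le> x \<and> x \<le> real n + 1 \<and> - real m - 1 \<le> y \<and> y \<le> 0" if "(x, y) \<in> cell i j" for x y
  proof -
    have y: "- real i - 1 \<le> y" "y \<le> - real i" "line i j y \<le> x" "x \<le> line i (Suc j) y"
      using that ij by (auto simp: cell_def)
    have my: "- real m - 1 \<le> y" using y ij by linarith
    have "line i (Suc j) y \<le> line i (n + 1) y" using line_mono[of "Suc j" "n + 1" i y] my ij by simp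
    also have "\<dots> = real n + 1" by (simp add: line_def)
    finally have 1: "x \<le> real n + 1" using y by simp
    have "0 \<le> line i j y"
      unfolding line_def using y ij by (auto intro!: add_nonneg_nonneg mult_nonneg_nonneg)
    thus ?thesis using 1 y my by auto
  qed
  thus ?thesis by auto
qed

text \<open>A nonzero height occurs only on cells that are not exterior, and these all lie in one
  rectangle.\<close>

lemma height_unbounded_component:
  assumes H: "height H" and "i \<le> Suc m" "j \<le> n"
    and "\<not> bounded (connected_component_set (- drawn) (inner_point i j))"
  shows "H i j = 0"
proof (rule ccontr)
  assume neq: "H i j \<noteq> 0"
  have "connected_component_set (- drawn) (inner_point i j) \<subseteq> {0..real n + 1} \<times> {- real m - 1..0}"
  proof
    fix z assume "z \<in> connected_component_set (- drawn) (inner_point i j)"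
    then obtain k l where kl: "k \<le> Suc m" "l \<le> n" "z \<in> cell k l" "H k l = H i j"
      using component_in_level_cells[OF H] assms by blast
    hence "\<not> exterior k l" using height_exterior[OF H] neq by metis
    thus "z \<in> {0..real n + 1} \<times> {- real m - 1..0}" using bounded_inner_cell kl by blast
  qed
  moreover have "bounded ({0..real n + 1} \<times> {- real m - 1..(0::real)})"
    by (intro bounded_Times bounded_closed_interval)
  ultimately show False using assms bounded_subset by blast
qed

end

section \<open>Partial sums and corner sums\<close>

lemma pos_le_iff: "pos i \<le> pos j \<longleftrightarrow> i \<le> j"
proof
  assume "pos i \<le> pos j"
  show "i \<le> j"
  proof (rule ccontr)
    assume "\<not> i \<le> j"
    hence "{..j} \<subset> {..i}" by auto
    hence "pos j < pos i" unfolding pos_def by (intro psubset_card_mono) auto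
    thus False using \<open>pos i \<le> pos j\<close> by simp
  qed
qed (auto simp: pos_def intro!: card_mono)

lemma pos_eq_iff [simp]: "pos i = pos j \<longleftrightarrow> i = j"
  using pos_le_iff by (metis order_antisym order_refl)

lemma pos_ge_1: "1 \<le> pos i"
  by (auto simp: pos_def Suc_le_eq card_gt_0_iff)

lemma pos_neq_0 [simp]: "pos i \<noteq> 0"
  using pos_ge_1[of i] by linarith

lemma pos_le_card:
  fixes i :: "'a::{finite,linorder}"
  shows "pos i \<le> CARD('a)"
  unfolding pos_def by (intro card_mono) auto

lemma range_pos: "range (pos :: 'a::{finite,linorder} \<Rightarrow> nat) = {1..CARD('a::{finite,linorder})}"
proof (rule card_subset_eq)
  show "card (range (pos :: 'a \<Rightarrow> nat)) = card {1..CARD('a)}"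
    by (simp add: card_image inj_on_def)
qed (use pos_ge_1 pos_le_card in auto)

lemma pos_surj:
  assumes "1 \<le> s" "s \<le> CARD('a::{finite,linorder})"
  obtains i :: "'a::{finite,linorder}" where "pos i = s"
proof -
  have "s \<in> range (pos :: 'a \<Rightarrow> nat)" unfolding range_pos using assms by auto
  thus ?thesis using that by blast
qed

lemma atMost_eq_pos: "{..i} = {k. pos k \<le> pos i}"
  by (auto simp: pos_le_iff)

lemma pos_initial_insert:
  "{k. pos k \<le> pos i} = insert i {k. pos k \<le> pos i - 1}" "i \<notin> {k. pos k \<le> pos i - 1}"
proof -
  have "pos k \<le> pos i \<longleftrightarrow> k = i \<or> pos k \<le> pos i - 1" for k
    using pos_eq_iff[of k i] by (metis Suc_pred' le_Suc_eq less_eq_Suc_le order_refl pos_ge_1 One_nat_def)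
  thus "{k. pos k \<le> pos i} = insert i {k. pos k \<le> pos i - 1}" by auto
  show "i \<notin> {k. pos k \<le> pos i - 1}" using pos_ge_1[of i] by auto
qed

lemma pos_last:
  fixes j :: "'a::{finite,linorder}"
  shows "pos j = CARD('a) \<Longrightarrow> {..j} = UNIV"
  unfolding atMost_eq_pos using pos_le_card by auto

lemma sum_pos_telescope:
  fixes g :: "nat \<Rightarrow> real"
  assumes "s \<le> CARD('a::{finite,linorder})"
  shows "(\<Sum>k | pos (k :: 'a::{finite,linorder}) \<le> s. g (pos k) - g (pos k - 1)) = g s - g 0"
  using assms
proof (induction s)
  case 0
  show ?case by simp
next
  case (Suc s)
  obtain i :: 'a where i: "pos i = Suc s" using Suc.prems by (metis le_add1 plus_1_eq_Suc pos_surj)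
  show ?case
    using Suc pos_initial_insert[of i] by (simp add: i)
qed

section \<open>Corner sums and the matrix with given corner sums\<close>

definition corner_sum :: "real^'n::{finite,linorder}^'m::{finite,linorder} \<Rightarrow> nat \<Rightarrow> nat \<Rightarrow> real" where
  "corner_sum X s t = (\<Sum>k | pos k \<le> s. \<Sum>l | pos l \<le> t. X $ k $ l)"

lemma corner_sum_0 [simp]: "corner_sum X 0 t = 0" "corner_sum X s 0 = 0"
  by (simp_all add: corner_sum_def)

lemma col_partial_sum_corner:
  "col_partial_sum X i j = corner_sum X (pos i) (pos j) - corner_sum X (pos i) (pos j - 1)"
proof -
  have "corner_sum X (pos i) (pos j) = (\<Sum>k | pos k \<le> pos i. X $ k $ j + (\<Sum>l | pos l \<le> pos j - 1. X $ k $ l))"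
    unfolding corner_sum_def pos_initial_insert(1)[of j]
    using pos_initial_insert(2)[of j] by (subst sum.insert) auto
  thus ?thesis
    by (simp add: corner_sum_def col_partial_sum_def sum.distrib atMost_eq_pos)
qed

lemma row_partial_sum_corner:
  "row_partial_sum X i j = corner_sum X (pos i) (pos j) - corner_sum X (pos i - 1) (pos j)"
  unfolding corner_sum_def pos_initial_insert(1)[of i]
  using pos_initial_insert(2)[of i] by (simp add: row_partial_sum_def atMost_eq_pos)

lemma row_partial_sum_last:
  fixes X :: "real^'n::{finite,linorder}^'m::{finite,linorder}"
  shows "pos j = CARD('n) \<Longrightarrow> row_partial_sum X i j = (\<Sum>j\<in>UNIV. X $ i $ j)"
  by (simp add: row_partial_sum_def pos_last)

lemma entry_col_partial_sum:
  "pos i = 1 \<Longrightarrow> X $ i $ j = col_partial_sum X i j"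
  "pos i = Suc (pos k) \<Longrightarrow> X $ i $ j = col_partial_sum X i j - col_partial_sum X k j"
proof -
  have eq: "col_partial_sum X i j = X $ i $ j + (\<Sum>l | pos l \<le> pos i - 1. X $ l $ j)"
    unfolding col_partial_sum_def atMost_eq_pos pos_initial_insert(1)[of i]
    using pos_initial_insert(2)[of i] by (subst sum.insert) auto
  show "pos i = 1 \<Longrightarrow> X $ i $ j = col_partial_sum X i j" using eq by simp
  show "pos i = Suc (pos k) \<Longrightarrow> X $ i $ j = col_partial_sum X i j - col_partial_sum X k j"
    using eq by (simp add: col_partial_sum_def atMost_eq_pos)
qed

lemma row_cases:
  fixes i :: "'a::{finite,linorder}"
  obtains "pos i = 1" | k :: 'a where "pos i = Suc (pos k)"
proof (cases "pos i = 1")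
  case False
  hence "1 \<le> pos i - 1" "pos i - 1 \<le> CARD('a)" using pos_ge_1[of i] pos_le_card[of i] by auto
  then obtain k :: 'a where "pos k = pos i - 1" by (metis pos_surj)
  thus ?thesis using that(2)[of k] pos_ge_1[of i] by simp
qed (use that in blast)

text \<open>Each entry is a difference of two consecutive column partial sums.\<close>

lemma col_partial_sums_determine:
  assumes "\<And>i j. col_partial_sum X i j = col_partial_sum Y i j"
  shows "X = Y"
proof -
  have "X $ i $ j = Y $ i $ j" for i j
    by (cases i rule: row_cases) (simp_all add: entry_col_partial_sum assms)
  thus ?thesis by (simp add: vec_eq_iff)
qed

lemma linear_corner_sum: "linear (\<lambda>X. corner_sum X s t)"
  by (rule linearI) (simp_all add: corner_sum_def sum.distrib sum_distrib_left)

lemma linear_col_partial_sum: "linear (\<lambda>X. col_partial_sum X i j)"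
  by (rule linearI) (simp_all add: col_partial_sum_def sum.distrib sum_distrib_left)

lemma linear_row_partial_sum: "linear (\<lambda>X. row_partial_sum X i j)"
  by (rule linearI) (simp_all add: row_partial_sum_def sum.distrib sum_distrib_left)

lemma linear_row_total: "linear (\<lambda>X :: real^'n::finite^'m. \<Sum>j\<in>UNIV. X $ i $ j)"
  by (rule linearI) (simp_all add: sum.distrib sum_distrib_left)

lemmas partial_sum_linear_simps =
  linear_add[OF linear_col_partial_sum] linear_diff[OF linear_col_partial_sum] linear_cmul[OF linear_col_partial_sum]
  linear_add[OF linear_row_partial_sum] linear_diff[OF linear_row_partial_sum] linear_cmul[OF linear_row_partial_sum]
  linear_add[OF linear_corner_sum] linear_diff[OF linear_corner_sum] linear_cmul[OF linear_corner_sum]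

text \<open>The mixed second difference. It inverts \<open>corner_sum\<close> on functions that
  vanish on both axes, and so turns a change of heights into a change of the matrix.\<close>

definition of_heights :: "(nat \<Rightarrow> nat \<Rightarrow> real) \<Rightarrow> real^'n::{finite,linorder}^'m::{finite,linorder}" where
  "of_heights h = (\<chi> i j. (h (pos i) (pos j) - h (pos i - 1) (pos j)) -
                          (h (pos i) (pos j - 1) - h (pos i - 1) (pos j - 1)))"

lemma corner_sum_of_heights:
  assumes "\<And>t. h 0 t = 0" "\<And>s. h s 0 = 0"
    and "s \<le> CARD('m::{finite,linorder})" "t \<le> CARD('n::{finite,linorder})"
  shows "corner_sum (of_heights h :: real^'n::{finite,linorder}^'m::{finite,linorder}) s t = h s t"
proof -
  have "(\<Sum>l | pos (l :: 'n) \<le> t. (h a (pos l) - h b (pos l)) - (h a (pos l - 1) - h b (pos l - 1))) =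
    h a t - h b t" for a b
    using sum_pos_telescope[where 'a = 'n and s = t and g = "\<lambda>t. h a t - h b t", OF assms(4)] assms(2)
    by simp
  hence "corner_sum (of_heights h :: real^'n::{finite,linorder}^'m::{finite,linorder}) s t =
    (\<Sum>k | pos (k :: 'm) \<le> s. h (pos k) t - h (pos k - 1) t)"
    unfolding corner_sum_def of_heights_def by simp
  also have "\<dots> = h s t"
    using sum_pos_telescope[where 'a = 'm and s = s and g = "\<lambda>s. h s t", OF assms(3)] assms(1) by simp
  finally show ?thesis .
qed

lemma partial_sums_of_heights:
  fixes i :: "'m::{finite,linorder}" and j :: "'n::{finite,linorder}"
  assumes "\<And>t. h 0 t = 0" "\<And>s. h s 0 = 0"
  shows "col_partial_sum (of_heights h :: real^'n::{finite,linorder}^'m::{finite,linorder}) i j = h (pos i) (pos j) - h (pos i) (pos j - 1)"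
    and "row_partial_sum (of_heights h :: real^'n::{finite,linorder}^'m::{finite,linorder}) i j = h (pos i) (pos j) - h (pos i - 1) (pos j)"
proof -
  note le = pos_le_card[of i] pos_le_card[of j] le_trans[OF diff_le_self pos_le_card[of i]]
    le_trans[OF diff_le_self pos_le_card[of j]]
  note eq = corner_sum_of_heights[where 'm = 'm and 'n = 'n and h = h, OF assms]
  show "col_partial_sum (of_heights h :: real^'n::{finite,linorder}^'m::{finite,linorder}) i j = h (pos i) (pos j) - h (pos i) (pos j - 1)"
    by (simp add: col_partial_sum_corner eq le)
  show "row_partial_sum (of_heights h :: real^'n::{finite,linorder}^'m::{finite,linorder}) i j = h (pos i) (pos j) - h (pos i - 1) (pos j)"
    by (simp add: row_partial_sum_corner eq le)
qed

section \<open>The inequality description of the polytope\<close>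

definition flow_polytope :: "nat list \<Rightarrow> (real^'n::{finite,linorder}^'m::{finite,linorder}) set" where
  "flow_polytope p = {X.
     (\<forall>i j. 0 \<le> col_partial_sum X i j \<and> col_partial_sum X i j \<le> 1 \<and> 0 \<le> row_partial_sum X i j) \<and>
     (\<forall>i. (\<Sum>j\<in>UNIV. X $ i $ j) = real (row_total p i))}"

lemma sign_matrices_subset_flow_polytope: "sign_matrices p \<subseteq> flow_polytope p"
proof
  fix X :: "real^'n::{finite,linorder}^'m::{finite,linorder}"
  assume X: "X \<in> sign_matrices p"
  have "0 \<le> col_partial_sum X i j \<and> col_partial_sum X i j \<le> 1 \<and> 0 \<le> row_partial_sum X i j" for i j
  proof -
    have "col_partial_sum X i j \<in> {0, 1}" "0 \<le> row_partial_sum X i j"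
      using X unfolding sign_matrices_def sign_matrix_def by blast+
    thus ?thesis by auto
  qed
  thus "X \<in> flow_polytope p" using X by (simp add: flow_polytope_def sign_matrices_def)
qed

lemma eventually_perturbation_nonneg:
  fixes a b :: real
  assumes "0 \<le> a" "a = 0 \<Longrightarrow> b = 0"
  shows "\<forall>\<^sub>F t in nhds 0. 0 \<le> a + t * b"
proof (cases "a = 0")
  case False
  have "((\<lambda>t. a + t * b) \<longlongrightarrow> a + 0 * b) (nhds 0)"
    by (intro tendsto_intros filterlim_ident)
  hence "\<forall>\<^sub>F t in nhds 0. 0 < a + t * b"
    by (rule order_tendstoD) (use False assms in simp)
  thus ?thesis by (rule eventually_mono) simp
qed (use assms in simp)

text \<open>There are finitely many inequalities: the strict ones survive a small move, and
  \<open>V\<close> leaves the attained ones unchanged. Both signs of \<open>t\<close> are allowed,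
  since extreme points are excluded by moving in two opposite directions.\<close>

lemma flow_polytope_perturbation:
  assumes X: "X \<in> flow_polytope p"
    and c: "\<And>i j. col_partial_sum X i j \<in> {0, 1} \<Longrightarrow> col_partial_sum V i j = 0"
    and r: "\<And>i j. row_partial_sum X i j = 0 \<Longrightarrow> row_partial_sum V i j = 0"
    and total: "\<And>i. (\<Sum>j\<in>UNIV. V $ i $ j) = 0"
  obtains e where "0 < e" "\<And>t. \<bar>t\<bar> \<le> e \<Longrightarrow> X + t *\<^sub>R V \<in> flow_polytope p"
proof -
  have bounds: "0 \<le> col_partial_sum X i j" "col_partial_sum X i j \<le> 1" "0 \<le> row_partial_sum X i j" for i j
    using X by (auto simp: flow_polytope_def)
  have "\<forall>\<^sub>F t in nhds 0. \<forall>i j. 0 \<le> col_partial_sum X i j + t * col_partial_sum V i j \<and>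
      0 \<le> (1 - col_partial_sum X i j) + t * (- col_partial_sum V i j) \<and>
      0 \<le> row_partial_sum X i j + t * row_partial_sum V i j"
    using bounds c r
    by (intro eventually_all_finite eventually_conj eventually_perturbation_nonneg) auto
  then obtain d where "0 < d" and d: "\<And>t i j. dist t 0 < d \<Longrightarrow>
      0 \<le> col_partial_sum X i j + t * col_partial_sum V i j \<and>
      0 \<le> (1 - col_partial_sum X i j) + t * (- col_partial_sum V i j) \<and>
      0 \<le> row_partial_sum X i j + t * row_partial_sum V i j"
    unfolding eventually_nhds_metric by blast
  have "X + t *\<^sub>R V \<in> flow_polytope p" if "\<bar>t\<bar> \<le> d / 2" for t
  proof -
    have "dist t 0 < d" using that \<open>0 < d\<close> by (simp add: dist_norm)
    moreover have "(\<Sum>j\<in>UNIV. (X + t *\<^sub>R V) $ i $ j) = real (row_total p i)" for i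
      using X total[of i] by (simp add: flow_polytope_def sum.distrib flip: sum_distrib_left)
    moreover have "col_partial_sum X i j + t * col_partial_sum V i j \<le> 1" for i j
      using d[OF \<open>dist t 0 < d\<close>, of i j] by linarith
    ultimately show ?thesis
      using d[of t] by (auto simp: flow_polytope_def partial_sum_linear_simps)
  qed
  thus ?thesis using that[of "d / 2"] \<open>0 < d\<close> by simp
qed

text \<open>The last column is thus in the zero class modulo 1, as are the axes. Shifting a nonzero
  class leaves it fixed and so preserves the row totals.\<close>

lemma flow_polytope_last_corner_sum:
  fixes X :: "real^'n::{finite,linorder}^'m::{finite,linorder}"
  assumes "X \<in> flow_polytope p"
  shows "corner_sum X s CARD('n) \<in> \<int>"
proof -
  have "corner_sum X s CARD('n) = (\<Sum>k | pos (k :: 'm) \<le> s. real (row_total p k))"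
    using assms pos_le_card[where 'a = 'n] by (simp add: corner_sum_def flow_polytope_def)
  thus ?thesis by (simp add: Ints_sum)
qed

lemma frac_eq_of_diff_Ints: "x - y \<in> \<int> \<Longrightarrow> frac x = frac (y :: real)"
  by (elim Ints_cases) (simp add: frac_def diff_eq_eq)

text \<open>
  The corner sums in a fixed nonzero class modulo 1 can be shifted simultaneously, in both
  directions, without leaving any constraint that is attained with equality.
\<close>

lemma extreme_flow_corner_sum_Ints:
  fixes X :: "real^'n::{finite,linorder}^'m::{finite,linorder}"
  assumes X: "X extreme_point_of flow_polytope p" and st: "s \<le> CARD('m)" "t \<le> CARD('n)"
  shows "corner_sum X s t \<in> \<int>"
proof (rule ccontr)
  assume nint: "corner_sum X s t \<notin> \<int>"
  define h where "h a b = (if frac (corner_sum X a b) = frac (corner_sum X s t) then 1 else 0 :: real)" for a b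
  define V :: "real^'n::{finite,linorder}^'m::{finite,linorder}" where "V = of_heights h"
  have FX: "X \<in> flow_polytope p" using X by (simp add: extreme_point_of_def)
  have int0: "h a b = 0" if "corner_sum X a b \<in> \<int>" for a b
    using that nint by (metis frac_eq_0_iff h_def)
  have h0: "h 0 b = 0" "h a 0 = 0" for a b by (simp_all add: int0)
  have heq: "h a b = h a' b'" if "corner_sum X a b - corner_sum X a' b' \<in> \<int>" for a b a' b'
    using frac_eq_of_diff_Ints[OF that] by (simp add: h_def)
  obtain jl :: 'n where jl: "pos jl = CARD('n)"
    using pos_surj[of "CARD('n)", where 'a = 'n] by (metis One_nat_def Suc_leI order_refl zero_less_card_finite)
  obtain e where e: "0 < e" "\<And>t. \<bar>t\<bar> \<le> e \<Longrightarrow> X + t *\<^sub>R V \<in> flow_polytope p"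
  proof (rule flow_polytope_perturbation[OF FX, of V])
    fix i j
    show "col_partial_sum V i j = 0" if "col_partial_sum X i j \<in> {0, 1}"
    proof -
      \<comment> \<open>An attained bound makes the two adjacent corner sums differ by an integer;
        they are in the same class and are shifted together.\<close>
      have "col_partial_sum X i j \<in> \<int>" using that by auto
      thus ?thesis unfolding V_def partial_sums_of_heights(1)[of h, OF h0]
        using heq by (simp add: col_partial_sum_corner)
    qed
    show "row_partial_sum V i j = 0" if "row_partial_sum X i j = 0"
    proof -
      have "row_partial_sum X i j \<in> \<int>" using that by auto
      thus ?thesis unfolding V_def partial_sums_of_heights(2)[of h, OF h0]
        using heq by (simp add: row_partial_sum_corner)
    qed
  next
    fix i
    have "row_partial_sum V i jl = 0"
      unfolding V_def partial_sums_of_heights(2)[of h, OF h0]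
      by (simp add: jl int0 flow_polytope_last_corner_sum[OF FX])
    thus "(\<Sum>j\<in>UNIV. V $ i $ j) = 0" using row_partial_sum_last[OF jl] by metis
  qed (use that in blast)
  have "corner_sum V s t = 1"
    unfolding V_def using corner_sum_of_heights[of h, OF h0 st] by (simp add: h_def)
  hence "V \<noteq> 0" using linear_0[OF linear_corner_sum] by (metis zero_neq_one)
  have "X + e *\<^sub>R V \<in> flow_polytope p" "X + (- e) *\<^sub>R V \<in> flow_polytope p"
    using e by (intro e(2); simp)+
  moreover have "X \<in> open_segment (X + e *\<^sub>R V) (X + (- e) *\<^sub>R V)"
  proof -
    have "X = (1 - 1/2) *\<^sub>R (X + e *\<^sub>R V) + (1/2) *\<^sub>R (X + (- e) *\<^sub>R V)"
      by (simp add: algebra_simps flip: scaleR_add_left)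
    moreover have "X + e *\<^sub>R V \<noteq> X + (- e) *\<^sub>R V"
    proof
      assume "X + e *\<^sub>R V = X + (- e) *\<^sub>R V"
      hence "(2 * e) *\<^sub>R V = 0" by (simp add: algebra_simps flip: scaleR_add_left)
      thus False using e \<open>V \<noteq> 0\<close> by simp
    qed
    ultimately show ?thesis unfolding in_segment by (intro conjI exI[of _ "1/2"]) auto
  qed
  ultimately show False using X by (auto simp: extreme_point_of_def)
qed

text \<open>Integral corner sums have integral differences, so the column partial sums are integers
  in \<open>[0,1]\<close>, and the entries, being differences of these, lie in
  \<open>{-1,0,1}\<close>.\<close>

lemma extreme_flow_sign_matrix:
  fixes X :: "real^'n::{finite,linorder}^'m::{finite,linorder}"
  assumes X: "X extreme_point_of flow_polytope p"
  shows "X \<in> sign_matrices p"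
proof -
  have FX: "X \<in> flow_polytope p" using X by (simp add: extreme_point_of_def)
  have c: "col_partial_sum X i j \<in> {0, 1}" for i j
  proof -
    have "col_partial_sum X i j \<in> \<int>"
      unfolding col_partial_sum_corner
      by (intro Ints_diff extreme_flow_corner_sum_Ints[OF X] pos_le_card le_trans[OF diff_le_self pos_le_card])
    then obtain z where z: "col_partial_sum X i j = of_int z" by (auto elim: Ints_cases)
    moreover have "0 \<le> col_partial_sum X i j" "col_partial_sum X i j \<le> 1"
      using FX by (auto simp: flow_polytope_def)
    ultimately have "0 \<le> z" "z \<le> 1" by simp_all
    hence "z = 0 \<or> z = 1" by linarith
    thus ?thesis using z by auto
  qed
  have "X $ i $ j \<in> {-1, 0, 1}" for i j
  proof (cases i rule: row_cases)
    case 1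
    thus ?thesis using c[of i j] entry_col_partial_sum(1)[of i X j] by auto
  next
    case (2 k)
    thus ?thesis using c[of i j] c[of k j] entry_col_partial_sum(2)[of i k X j] by auto
  qed
  thus ?thesis using c FX by (simp add: sign_matrices_def sign_matrix_def flow_polytope_def)
qed

lemma convex_combination_zero:
  fixes a b u :: real
  assumes "0 \<le> a" "0 \<le> b" "0 < u" "u < 1" "(1 - u) * a + u * b = 0"
  shows "a = 0 \<and> b = 0"
proof -
  have "0 \<le> (1 - u) * a" "0 \<le> u * b" using assms by auto
  hence "(1 - u) * a = 0" "u * b = 0" using assms(5) by linarith+
  thus ?thesis using assms by simp
qed

text \<open>Every column partial sum of \<open>X\<close> is an endpoint of \<open>[0,1]\<close>, so
  the two ends of a segment through \<open>X\<close> share it. Column partial sums determine the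
  matrix, hence the ends coincide.\<close>

lemma sign_matrix_extreme_flow:
  assumes "X \<in> sign_matrices p"
  shows "X extreme_point_of flow_polytope p"
proof -
  have False if Y: "Y \<in> flow_polytope p" "Z \<in> flow_polytope p" "X \<in> open_segment Y Z" for Y Z
  proof -
    obtain u where u: "0 < u" "u < 1" "X = (1 - u) *\<^sub>R Y + u *\<^sub>R Z" "Y \<noteq> Z"
      using Y by (auto simp: in_segment)
    have "col_partial_sum Y i j = col_partial_sum Z i j" for i j
    proof -
      let ?y = "col_partial_sum Y i j" and ?z = "col_partial_sum Z i j"
      have yz: "0 \<le> ?y" "?y \<le> 1" "0 \<le> ?z" "?z \<le> 1"
        using Y by (auto simp: flow_polytope_def)
      have eq: "col_partial_sum X i j = (1 - u) * ?y + u * ?z"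
        by (simp add: u partial_sum_linear_simps)
      have "col_partial_sum X i j \<in> {0, 1}"
        using assms unfolding sign_matrices_def sign_matrix_def by blast
      then consider "(1 - u) * ?y + u * ?z = 0" | "(1 - u) * (1 - ?y) + u * (1 - ?z) = 0"
        using eq by (auto simp: algebra_simps)
      thus ?thesis
        using convex_combination_zero[of ?y ?z u] convex_combination_zero[of "1 - ?y" "1 - ?z" u] yz u
        by cases auto
    qed
    thus False using col_partial_sums_determine u by blast
  qed
  thus ?thesis using assms sign_matrices_subset_flow_polytope by (auto simp: extreme_point_of_def)
qed

lemma convex_flow_polytope: "convex (flow_polytope p)"
proof (rule convexI)
  fix X Y :: "real^'n::{finite,linorder}^'m::{finite,linorder}" and u v :: real
  assume XY: "X \<in> flow_polytope p" "Y \<in> flow_polytope p" and uv: "0 \<le> u" "0 \<le> v" "u + v = 1"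
  have "u * real (row_total p i) + v * real (row_total p i) = real (row_total p i)" for i :: 'm
    by (metis uv(3) distrib_right mult_1)
  thus "u *\<^sub>R X + v *\<^sub>R Y \<in> flow_polytope p"
    using XY uv by (auto simp: flow_polytope_def partial_sum_linear_simps sum.distrib convex_bound_le
        simp flip: sum_distrib_left)
qed

text \<open>For boundedness: an entry is a number in \<open>[0,1]\<close> or a difference of two
  such numbers.\<close>

lemma compact_flow_polytope: "compact (flow_polytope p :: (real^'n::{finite,linorder}^'m::{finite,linorder}) set)"
proof -
  note cont = linear_continuous_on[OF linear_conv_bounded_linear[THEN iffD1]]
  have "closed (flow_polytope p :: (real^'n::{finite,linorder}^'m::{finite,linorder}) set)"
    unfolding flow_polytope_def
    by (intro closed_Collect_conj closed_Collect_all closed_Collect_le closed_Collect_eq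
        cont linear_col_partial_sum linear_row_partial_sum linear_row_total continuous_on_const)
  moreover have "bounded (flow_polytope p :: (real^'n::{finite,linorder}^'m::{finite,linorder}) set)"
  proof (rule boundedI)
    fix X :: "real^'n::{finite,linorder}^'m::{finite,linorder}" assume X: "X \<in> flow_polytope p"
    have "\<bar>X $ i $ j\<bar> \<le> 1" for i j
    proof (cases i rule: row_cases)
      case 1
      thus ?thesis using X entry_col_partial_sum(1)[of i X j] by (auto simp: flow_polytope_def)
    next
      case (2 k)
      have "0 \<le> col_partial_sum X l j" "col_partial_sum X l j \<le> 1" for l
        using X by (auto simp: flow_polytope_def)
      from this[of i] this[of k] show ?thesis
        using entry_col_partial_sum(2)[OF 2, of X j] by linarith
    qed
    hence "norm (X $ i) \<le> real CARD('n)" for i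
      using norm_le_l1_cart[of "X $ i"] sum_bounded_above[of UNIV "\<lambda>j. \<bar>X $ i $ j\<bar>" 1]
      by (metis mult.right_neutral order_trans)
    hence "(\<Sum>i\<in>UNIV. norm (X $ i)) \<le> real CARD('m) * real CARD('n)"
      using sum_bounded_above[of UNIV "\<lambda>i. norm (X $ i)"] by simp
    moreover have "norm X \<le> (\<Sum>i\<in>UNIV. norm (X $ i))"
      unfolding norm_vec_def by (rule L2_set_le_sum) simp
    ultimately show "norm X \<le> real CARD('m) * real CARD('n)" by simp
  qed
  ultimately show ?thesis by (simp add: compact_eq_bounded_closed)
qed

lemma extreme_points_flow_polytope: "{X. X extreme_point_of flow_polytope p} = sign_matrices p"
  using extreme_flow_sign_matrix sign_matrix_extreme_flow by blast

text \<open>A compact convex set in finite dimension is the convex hull of its extreme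
  points.\<close>

lemma sign_polytope_eq_flow_polytope: "sign_polytope p = flow_polytope p"
  unfolding sign_polytope_def
  using Krein_Milman_Minkowski[OF compact_flow_polytope convex_flow_polytope, of p]
  by (metis extreme_points_flow_polytope)

section \<open>Faces and components\<close>

lemma face_sign_matrices:
  assumes "F face_of flow_polytope p"
  shows "{X \<in> sign_matrices p. X extreme_point_of F} = sign_matrices p \<inter> F"
  using extreme_point_of_face[OF assms] sign_matrix_extreme_flow by blast

lemma face_eq_hull:
  assumes F: "F face_of flow_polytope p"
  shows "F = convex hull (sign_matrices p \<inter> F)"
proof -
  have "compact F" using face_of_imp_compact[OF convex_flow_polytope compact_flow_polytope F] .
  hence "F = convex hull {X. X extreme_point_of F}"
    by (rule Krein_Milman_Minkowski[OF _ face_of_imp_convex[OF F]])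
  also have "{X. X extreme_point_of F} = sign_matrices p \<inter> F"
    using extreme_point_of_face[OF F] extreme_points_flow_polytope[of p] by blast
  finally show ?thesis .
qed

text \<open>For a nonempty set \<open>S\<close> of sign matrices this is the smallest face through
  \<open>S\<close>: every inequality attained on all of \<open>S\<close> is turned into an
  equation.\<close>

definition tight_face ::
    "nat list \<Rightarrow> (real^'n::{finite,linorder}^'m::{finite,linorder}) set \<Rightarrow>
      (real^'n::{finite,linorder}^'m::{finite,linorder}) set" where
  "tight_face p S = {X \<in> flow_polytope p. \<forall>i j.
     ((\<forall>Y\<in>S. col_partial_sum Y i j = 0) \<longrightarrow> col_partial_sum X i j = 0) \<and>
     ((\<forall>Y\<in>S. col_partial_sum Y i j = 1) \<longrightarrow> col_partial_sum X i j = 1) \<and>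
     ((\<forall>Y\<in>S. row_partial_sum Y i j = 0) \<longrightarrow> row_partial_sum X i j = 0)}"

text \<open>A nonnegative quantity that vanishes inside a segment vanishes at both ends. The upper
  bound enters as nonnegativity of \<open>1 - col_partial_sum X i j\<close>.\<close>

lemma tight_face_face_of: "tight_face p S face_of flow_polytope p"
  unfolding face_of_def
proof (intro conjI ballI impI)
  show "tight_face p S \<subseteq> flow_polytope p" by (auto simp: tight_face_def)
  show "convex (tight_face p S)"
  proof (rule convexI)
    fix X Y and u v :: real
    assume *: "X \<in> tight_face p S" "Y \<in> tight_face p S" "0 \<le> u" "0 \<le> v" "u + v = 1"
    hence "u *\<^sub>R X + v *\<^sub>R Y \<in> flow_polytope p"
      by (intro convexD[OF convex_flow_polytope]) (auto simp: tight_face_def)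
    thus "u *\<^sub>R X + v *\<^sub>R Y \<in> tight_face p S"
      using * by (simp add: tight_face_def partial_sum_linear_simps)
  qed
  fix Y Z X assume *: "Y \<in> flow_polytope p" "Z \<in> flow_polytope p" "X \<in> tight_face p S" "X \<in> open_segment Y Z"
  obtain u where u: "0 < u" "u < 1" "X = (1 - u) *\<^sub>R Y + u *\<^sub>R Z"
    using * by (auto simp: in_segment)
  have Y: "0 \<le> col_partial_sum Y i j" "0 \<le> 1 - col_partial_sum Y i j" "0 \<le> row_partial_sum Y i j" for i j
    using * by (auto simp: flow_polytope_def)
  have Z: "0 \<le> col_partial_sum Z i j" "0 \<le> 1 - col_partial_sum Z i j" "0 \<le> row_partial_sum Z i j" for i j
    using * by (auto simp: flow_polytope_def)
  have 0: "col_partial_sum Y i j = 0 \<and> col_partial_sum Z i j = 0" if "col_partial_sum X i j = 0" for i j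
    using that convex_combination_zero[OF Y(1) Z(1) u(1,2), of i j i j] by (simp add: u(3) partial_sum_linear_simps)
  have 1: "col_partial_sum Y i j = 1 \<and> col_partial_sum Z i j = 1" if "col_partial_sum X i j = 1" for i j
  proof -
    have "(1 - u) * (1 - col_partial_sum Y i j) + u * (1 - col_partial_sum Z i j) = 0"
      using that by (simp add: u(3) partial_sum_linear_simps algebra_simps)
    thus ?thesis using convex_combination_zero[OF Y(2) Z(2) u(1,2), of i j i j] by simp
  qed
  have 2: "row_partial_sum Y i j = 0 \<and> row_partial_sum Z i j = 0" if "row_partial_sum X i j = 0" for i j
    using that convex_combination_zero[OF Y(3) Z(3) u(1,2), of i j i j] by (simp add: u(3) partial_sum_linear_simps)
  show "Y \<in> tight_face p S" "Z \<in> tight_face p S"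
    using *(1-3) 0 1 2 unfolding tight_face_def by blast+
qed

lemma subset_tight_face: "S \<subseteq> sign_matrices p \<Longrightarrow> S \<subseteq> tight_face p S"
  using sign_matrices_subset_flow_polytope[of p] by (auto simp: tight_face_def)

text \<open>The segment from \<open>X\<close> to \<open>W\<close> can be prolonged beyond
  \<open>W\<close> inside \<open>F\<close>. An affine function that is positive at \<open>X\<close>
  and zero at \<open>W\<close> would be negative there. The constant \<open>a\<close> admits
  functions such as one minus a column partial sum.\<close>

lemma rel_interior_zero:
  fixes F :: "'a::euclidean_space set" and f :: "'a \<Rightarrow> real"
  assumes "convex F" "W \<in> rel_interior F" "X \<in> F" "linear f"
    and nonneg: "\<And>X. X \<in> F \<Longrightarrow> 0 \<le> a + f X" and "a + f W = (0::real)"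
  shows "a + f X = 0"
proof -
  have "F \<noteq> {}" using assms by auto
  then obtain e where e: "1 < e" "(1 - e) *\<^sub>R X + e *\<^sub>R W \<in> F"
    using convex_rel_interior_iff[OF assms(1), of W] assms by auto
  have "0 \<le> a + f ((1 - e) *\<^sub>R X + e *\<^sub>R W)" using nonneg e by blast
  also have "\<dots> = (1 - e) * (a + f X) + e * (a + f W)"
    unfolding linear_add[OF assms(4)] linear_cmul[OF assms(4)] by (simp add: algebra_simps)
  finally have "(e - 1) * (a + f X) \<le> 0" using assms by (simp add: algebra_simps)
  hence "a + f X \<le> 0" using e by (simp add: mult_le_0_iff)
  thus ?thesis using nonneg[OF assms(3)] by simp
qed

lemma rel_interior_flow_face:
  assumes "convex F" "F \<subseteq> flow_polytope p" "W \<in> rel_interior F" "X \<in> F"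
  shows "col_partial_sum W i j = 0 \<Longrightarrow> col_partial_sum X i j = 0"
    and "col_partial_sum W i j = 1 \<Longrightarrow> col_partial_sum X i j = 1"
    and "row_partial_sum W i j = 0 \<Longrightarrow> row_partial_sum X i j = 0"
proof -
  note zero = rel_interior_zero[OF assms(1,3,4)]
  have F: "0 \<le> col_partial_sum X i j" "col_partial_sum X i j \<le> 1" "0 \<le> row_partial_sum X i j" if "X \<in> F" for X
    using that assms(2) by (auto simp: flow_polytope_def)
  show "col_partial_sum W i j = 0 \<Longrightarrow> col_partial_sum X i j = 0"
    using zero[OF linear_col_partial_sum, of 0 i j] F by simp
  show "col_partial_sum W i j = 1 \<Longrightarrow> col_partial_sum X i j = 1"
    using zero[OF linear_compose_neg[OF linear_col_partial_sum], of 1 i j] F by simp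
  show "row_partial_sum W i j = 0 \<Longrightarrow> row_partial_sum X i j = 0"
    using zero[OF linear_row_partial_sum, of 0 i j] F by simp
qed

lemma row_total_constant:
  "X \<in> flow_polytope p \<Longrightarrow> Y \<in> flow_polytope p \<Longrightarrow> (\<Sum>j\<in>UNIV. (X - Y) $ i $ j) = 0"
  by (simp add: flow_polytope_def sum_subtractf)

text \<open>A relative interior point \<open>W\<close> of \<open>F\<close> attains only what all of
  \<open>F\<close> attains, and \<open>X\<close> attains this too. So \<open>W\<close> can be moved
  a little away from \<open>X\<close> within the polytope, which puts \<open>W\<close> inside a
  segment ending in \<open>X\<close>; the face property then draws \<open>X\<close> into
  \<open>F\<close>.\<close>

lemma tight_face_of_face:
  fixes F :: "(real^'n::{finite,linorder}^'m::{finite,linorder}) set"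
  assumes F: "F face_of flow_polytope p" and "F \<noteq> {}"
  shows "tight_face p (sign_matrices p \<inter> F) = F"
proof
  have conv: "convex F" and sub: "F \<subseteq> flow_polytope p"
    using F face_of_imp_convex face_of_imp_subset by blast+
  show "F \<subseteq> tight_face p (sign_matrices p \<inter> F)"
    by (subst (1) face_eq_hull[OF F], rule hull_minimal)
      (rule subset_tight_face[OF Int_lower1], rule face_of_imp_convex[OF tight_face_face_of])
  show "tight_face p (sign_matrices p \<inter> F) \<subseteq> F"
  proof
    fix X assume X: "X \<in> tight_face p (sign_matrices p \<inter> F)"
    obtain W where W: "W \<in> rel_interior F" using assms(2) rel_interior_eq_empty[OF conv] by blast
    have WF: "W \<in> F" using W rel_interior_subset by blast
    have XP: "X \<in> flow_polytope p" using X by (simp add: tight_face_def)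
    note rel = rel_interior_flow_face[OF conv sub W]
    obtain e where e: "0 < e" "\<And>t. \<bar>t\<bar> \<le> e \<Longrightarrow> W + t *\<^sub>R (W - X) \<in> flow_polytope p"
    proof (rule flow_polytope_perturbation[of W p "W - X"])
      show "W \<in> flow_polytope p" using WF sub by blast
      show "col_partial_sum (W - X) i j = 0" if c01: "col_partial_sum W i j \<in> {0, 1}" for i j
      proof -
        consider "col_partial_sum W i j = 0" | "col_partial_sum W i j = 1" using c01 by blast
        hence "col_partial_sum X i j = col_partial_sum W i j"
        proof cases
          case 1
          hence "\<forall>Y\<in>sign_matrices p \<inter> F. col_partial_sum Y i j = 0" using rel(1)[of _ i j] by blast
          thus ?thesis using X 1 unfolding tight_face_def by simp
        next
          case 2
          hence "\<forall>Y\<in>sign_matrices p \<inter> F. col_partial_sum Y i j = 1" using rel(2)[of _ i j] by blast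
          thus ?thesis using X 2 unfolding tight_face_def by simp
        qed
        thus ?thesis by (simp add: partial_sum_linear_simps)
      qed
      show "row_partial_sum (W - X) i j = 0" if "row_partial_sum W i j = 0" for i j
      proof -
        have "\<forall>Y\<in>sign_matrices p \<inter> F. row_partial_sum Y i j = 0" using rel(3)[OF _ that] by blast
        hence "row_partial_sum X i j = 0" using X unfolding tight_face_def by simp
        thus ?thesis using that by (simp add: partial_sum_linear_simps)
      qed
      show "(\<Sum>j\<in>UNIV. (W - X) $ i $ j) = 0" for i
        using row_total_constant WF sub XP by blast
    qed (use that in blast)
    show "X \<in> F"
    proof (cases "X = W")
      case False
      \<comment> \<open>Since \<open>?Y - X\<close> is \<open>1 + e\<close> times
        \<open>W - X\<close>, the point \<open>W\<close> divides the segment from \<open>X\<close>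
        to \<open>?Y\<close> at the parameter \<open>1 / (1 + e)\<close>.\<close>
      let ?Y = "W + e *\<^sub>R (W - X)" and ?u = "1 / (1 + e)"
      have "?Y \<in> flow_polytope p" using e by simp
      moreover have "W \<in> open_segment X ?Y"
      proof -
        have "?Y - X = (1 + e) *\<^sub>R (W - X)" by (simp add: algebra_simps)
        hence "?u *\<^sub>R (?Y - X) = W - X" using e by simp
        hence "W = (1 - ?u) *\<^sub>R X + ?u *\<^sub>R ?Y" by (simp add: algebra_simps)
        moreover have "X \<noteq> ?Y"
        proof
          assume "X = ?Y"
          hence "(1 + e) *\<^sub>R (W - X) = 0" by (simp add: algebra_simps)
          thus False using False e by simp
        qed
        ultimately show ?thesis unfolding in_segment using e by (intro conjI exI[of _ ?u]) auto
      qed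
      ultimately show ?thesis using F XP WF unfolding face_of_def by blast
    qed (use WF in simp)
  qed
qed

section \<open>Labelings of sets of matrices and their order\<close>

definition component_of ::
    "nat list \<Rightarrow> (real^'n::{finite,linorder}^'m::{finite,linorder}) set \<Rightarrow> ('m, 'n) labeling" where
  "component_of p S = union_labeling p (zero_dim_component p ` S)"

lemma component_of_empty: "component_of p {} = empty_labeling"
  by (simp add: component_of_def union_labeling_def)

lemma component_of_apply:
  fixes S :: "(real^'n::{finite,linorder}^'m::{finite,linorder}) set"
  assumes "S \<noteq> {}"
  shows "component_of p S (Vert i j) = Values ((\<lambda>X. col_partial_sum X i j) ` S)"
    and "component_of p S (Horiz i j) =
      (if pos j < CARD('n) then if \<exists>X\<in>S. row_partial_sum X i j \<noteq> 0 then Star else Zero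
       else Fixed (row_total p i))"
proof -
  have "zero_dim_component p X \<noteq> empty_labeling" for X :: "real^'n::{finite,linorder}^'m::{finite,linorder}"
  proof
    assume "zero_dim_component p X = empty_labeling"
    hence "zero_dim_component p X (Vert undefined undefined) = Unlabeled" by (simp add: empty_labeling_def)
    thus False by simp
  qed
  hence "\<not> zero_dim_component p ` S \<subseteq> {empty_labeling}" using assms by blast
  thus "component_of p S (Vert i j) = Values ((\<lambda>X. col_partial_sum X i j) ` S)"
    "component_of p S (Horiz i j) =
      (if pos j < CARD('n) then if \<exists>X\<in>S. row_partial_sum X i j \<noteq> 0 then Star else Zero
       else Fixed (row_total p i))"
    by (auto simp: component_of_def union_labeling_def)
qed

lemma component_of_neq_empty: "S \<noteq> {} \<Longrightarrow> component_of p S \<noteq> empty_labeling"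
  using component_of_apply(1)[of S p undefined undefined] by (auto simp: empty_labeling_def)

lemma sign_matrix_col_partial_sum: "X \<in> sign_matrices p \<Longrightarrow> col_partial_sum X i j \<in> {0, 1}"
  unfolding sign_matrices_def sign_matrix_def by blast

text \<open>A label records which bounds hold with equality on the whole set, so containment means
  that every equality common to \<open>T\<close> also holds on \<open>S\<close>. As column partial
  sums are 0 or 1, a missing value on a vertical edge is the same as a common equality with the
  other value.\<close>

lemma component_of_le_iff:
  fixes S T :: "(real^'n::{finite,linorder}^'m::{finite,linorder}) set"
  assumes S: "S \<subseteq> sign_matrices p" "S \<noteq> {}" and T: "T \<subseteq> sign_matrices p" "T \<noteq> {}"
  shows "labeling_le (component_of p S) (component_of p T) \<longleftrightarrow> S \<subseteq> tight_face p T"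
proof
  assume le: "labeling_le (component_of p S) (component_of p T)"
  show "S \<subseteq> tight_face p T"
  proof
    fix X assume X: "X \<in> S"
    have XP: "X \<in> flow_polytope p" using X S sign_matrices_subset_flow_polytope by blast
    have vert: "col_partial_sum X i j \<in> (\<lambda>X. col_partial_sum X i j) ` T" for i j
    proof -
      have "label_le (component_of p S (Vert i j)) (component_of p T (Vert i j))"
        using le by (simp add: labeling_le_def)
      thus ?thesis using X by (auto simp: component_of_apply S(2) T(2))
    qed
    have horiz: "row_partial_sum X i j = 0" if "\<forall>Y\<in>T. row_partial_sum Y i j = 0" for i j
    proof (cases "pos j < CARD('n)")
      case True
      have "label_le (component_of p S (Horiz i j)) (component_of p T (Horiz i j))"
        using le by (simp add: labeling_le_def)
      thus ?thesis using X True that by (auto simp: component_of_apply S(2) T(2) split: if_splits)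
    next
      case False
      \<comment> \<open>Labels of final edges carry no information about the matrix, but the partial
        sum there is the prescribed row total, the same for \<open>X\<close> and for the members of
        \<open>T\<close>.\<close>
      hence j: "pos j = CARD('n)" using pos_le_card[of j] by simp
      obtain Y where Y: "Y \<in> T" using T by blast
      hence "Y \<in> flow_polytope p" using T sign_matrices_subset_flow_polytope by blast
      thus ?thesis using XP that Y by (auto simp: flow_polytope_def row_partial_sum_last[OF j])
    qed
    show "X \<in> tight_face p T"
      unfolding tight_face_def
    proof (intro CollectI conjI allI impI)
      fix i j
      obtain Y where "Y \<in> T" "col_partial_sum X i j = col_partial_sum Y i j" using vert[of i j] by blast
      thus "\<forall>Y\<in>T. col_partial_sum Y i j = 0 \<Longrightarrow> col_partial_sum X i j = 0"
        "\<forall>Y\<in>T. col_partial_sum Y i j = 1 \<Longrightarrow> col_partial_sum X i j = 1"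
        by simp_all
    qed (use XP horiz in blast)+
  qed
next
  assume sub: "S \<subseteq> tight_face p T"
  have "label_le (component_of p S e) (component_of p T e)" for e
  proof (cases e)
    case (Vert i j)
    have "col_partial_sum X i j \<in> (\<lambda>X. col_partial_sum X i j) ` T" if X: "X \<in> S" for X
    proof (rule ccontr)
      assume *: "col_partial_sum X i j \<notin> (\<lambda>X. col_partial_sum X i j) ` T"
      have T01: "col_partial_sum Y i j \<in> {0, 1}" if "Y \<in> T" for Y
        using sign_matrix_col_partial_sum[OF subsetD[OF T(1) that]] .
      have "X \<in> tight_face p T" using X sub by blast
      hence 0: "(\<forall>Y\<in>T. col_partial_sum Y i j = 0) \<longrightarrow> col_partial_sum X i j = 0"
        and 1: "(\<forall>Y\<in>T. col_partial_sum Y i j = 1) \<longrightarrow> col_partial_sum X i j = 1"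
        by (auto simp: tight_face_def)
      consider "col_partial_sum X i j = 0" | "col_partial_sum X i j = 1"
        using sign_matrix_col_partial_sum[OF subsetD[OF S(1) X], of i j] by blast
      thus False
      proof cases
        assume "col_partial_sum X i j = 0"
        moreover have "\<forall>Y\<in>T. col_partial_sum Y i j = 1" using * T01 calculation by force
        ultimately show False using 1 by simp
      next
        assume "col_partial_sum X i j = 1"
        moreover have "\<forall>Y\<in>T. col_partial_sum Y i j = 0" using * T01 calculation by force
        ultimately show False using 0 by simp
      qed
    qed
    thus ?thesis by (auto simp: Vert component_of_apply S(2) T(2))
  next
    case (Horiz i j)
    thus ?thesis using sub by (auto simp: component_of_apply S(2) T(2) tight_face_def)
  qed
  thus "labeling_le (component_of p S) (component_of p T)" by (simp add: labeling_le_def)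
qed

lemma labeling_le_antisym: "labeling_le d d' \<Longrightarrow> labeling_le d' d \<Longrightarrow> d = d'"
proof -
  assume le: "labeling_le d d'" "labeling_le d' d"
  have "l = l'" if "label_le l l'" "label_le l' l" for l l'
    using that by (cases l; cases l') auto
  thus "d = d'" using le by (auto simp: labeling_le_def)
qed

lemma labeling_le_empty_iff:
  fixes d :: "('m::{finite,linorder}, 'n::{finite,linorder}) labeling"
  shows "labeling_le d empty_labeling \<longleftrightarrow> d = empty_labeling"
proof
  assume le: "labeling_le d empty_labeling"
  have "l = Unlabeled" if "label_le l Unlabeled" for l using that by (cases l) auto
  thus "d = empty_labeling" using le by (auto simp: labeling_le_def empty_labeling_def)
qed (simp add: labeling_le_def empty_labeling_def)

lemma psi_eq_component_of:
  "F face_of flow_polytope p \<Longrightarrow> psi p F = component_of p (sign_matrices p \<inter> F)"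
  by (simp add: psi_def component_of_def face_sign_matrices)

lemma psi_empty: "psi p {} = empty_labeling"
  using psi_eq_component_of[OF empty_face_of, of p] by (simp add: component_of_empty)

lemma face_sign_matrices_nonempty:
  "F face_of flow_polytope p \<Longrightarrow> sign_matrices p \<inter> F = {} \<longleftrightarrow> F = {}"
  using face_eq_hull[of F p] by (metis convex_hull_empty inf_bot_right)

text \<open>For nonempty faces the order of labelings compares the vertices of \<open>F\<close> with
  the tight face of the vertices of \<open>G\<close>, which is \<open>G\<close> itself. The empty
  face has to be treated apart.\<close>

lemma psi_le_iff:
  assumes F: "F face_of flow_polytope p" and G: "G face_of flow_polytope p"
  shows "F \<subseteq> G \<longleftrightarrow> labeling_le (psi p F) (psi p G)"
proof (cases "F = {} \<or> G = {}")
  case True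
  thus ?thesis
  proof
    assume "F = {}"
    thus ?thesis by (simp add: psi_empty labeling_le_def) (simp add: empty_labeling_def)
  next
    assume G0: "G = {}"
    have "psi p F = empty_labeling \<longleftrightarrow> sign_matrices p \<inter> F = {}"
      unfolding psi_eq_component_of[OF F] using component_of_neq_empty component_of_empty by metis
    moreover have "psi p G = empty_labeling"
      by (simp add: G0 psi_empty)
    ultimately show ?thesis
      using face_sign_matrices_nonempty[OF F] G0 by (simp add: labeling_le_empty_iff)
  qed
next
  case False
  let ?S = "sign_matrices p \<inter> F" and ?T = "sign_matrices p \<inter> G"
  have ne: "?S \<noteq> {}" "?T \<noteq> {}"
    using False face_sign_matrices_nonempty F G by blast+
  have "labeling_le (psi p F) (psi p G) \<longleftrightarrow> ?S \<subseteq> G"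
    using component_of_le_iff[of ?S p ?T] ne tight_face_of_face[OF G] False
    by (simp add: psi_eq_component_of F G)
  also have "\<dots> \<longleftrightarrow> F \<subseteq> G"
  proof
    assume "?S \<subseteq> G"
    hence "convex hull ?S \<subseteq> G" by (rule hull_minimal) (rule face_of_imp_convex[OF G])
    thus "F \<subseteq> G" using face_eq_hull[OF F] by simp
  qed blast
  finally show ?thesis by simp
qed

lemma psi_bij_betw:
  "bij_betw (psi p) {F :: (real^'n::{finite,linorder}^'m::{finite,linorder}) set. F face_of flow_polytope p}
     (grid_components p)"
  unfolding bij_betw_def
proof (intro conjI equalityI subsetI)
  show "inj_on (psi p) {F. F face_of flow_polytope p}"
  proof (rule inj_onI)
    fix F G assume *: "F \<in> {F. F face_of flow_polytope p}" "G \<in> {F. F face_of flow_polytope p}" "psi p F = psi p G"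
    have FG: "F face_of flow_polytope p" "G face_of flow_polytope p" using * by simp_all
    \<comment> \<open>After rewriting with the equality of images both claims are reflexivity at
      \<open>psi p G\<close>, that is, the image of \<open>G \<subseteq> G\<close>.\<close>
    have "labeling_le (psi p F) (psi p G)" "labeling_le (psi p G) (psi p F)"
      unfolding *(3) using psi_le_iff[OF FG(2) FG(2)] by blast+
    thus "F = G"
      unfolding psi_le_iff[OF FG, symmetric] psi_le_iff[OF FG(2,1), symmetric] by (rule equalityI)
  qed
next
  fix d assume "d \<in> psi p ` {F. F face_of flow_polytope p}"
  then obtain F where F: "F face_of flow_polytope p" and d: "d = psi p F" by blast
  show "d \<in> grid_components p"
  proof (cases "F = {}")
    case True
    thus ?thesis by (simp add: d psi_empty grid_components_def)
  next
    case False
    hence "sign_matrices p \<inter> F \<noteq> {}" using face_sign_matrices_nonempty[OF F] by simp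
    thus ?thesis
      unfolding d psi_eq_component_of[OF F] grid_components_def component_of_def
      by (intro insertI2 CollectI exI[of _ "sign_matrices p \<inter> F"]) simp
  qed
next
  fix d :: "('m, 'n) labeling" assume "d \<in> grid_components p"
  then consider "d = empty_labeling"
    | S :: "(real^'n::{finite,linorder}^'m::{finite,linorder}) set" where "S \<noteq> {}" "S \<subseteq> sign_matrices p" "d = component_of p S"
    unfolding grid_components_def component_of_def by blast
  thus "d \<in> psi p ` {F. F face_of flow_polytope p}"
  proof cases
    case 1
    thus ?thesis by (intro image_eqI[of _ _ "{}"]) (simp_all add: psi_empty)
  next
    case 2
    \<comment> \<open>The set \<open>S\<close> need not contain all sign matrices of a face. Its
      tight face may have more vertices, but they attain the same common equalities, so the two
      labelings contain each other.\<close>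
    let ?F = "tight_face p S"
    let ?T = "sign_matrices p \<inter> ?F"
    have sub: "S \<subseteq> ?T" using 2 subset_tight_face by blast
    hence T: "?T \<noteq> {}" using 2 by blast
    hence F: "?F \<noteq> {}" by blast
    have "component_of p ?T = component_of p S"
    proof (rule labeling_le_antisym)
      show "labeling_le (component_of p ?T) (component_of p S)"
        using component_of_le_iff[of ?T p S] 2 T by simp
      show "labeling_le (component_of p S) (component_of p ?T)"
        using component_of_le_iff[of S p ?T] 2 T sub tight_face_of_face[OF tight_face_face_of F] by simp
    qed
    hence "d = psi p ?F" using psi_eq_component_of[OF tight_face_face_of, of p S] 2(3) by simp
    thus ?thesis by (intro image_eqI[of _ _ ?F] CollectI tight_face_face_of)
  qed
qed

section \<open>Dimension\<close>

text \<open>A partial sum is the jump of the corner sums across an edge, so these are the matrices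
  whose heights do not jump across undarkened edges.\<close>

definition directions :: "('m, 'n) labeling \<Rightarrow> (real^'n::{finite,linorder}^'m::{finite,linorder}) set" where
  "directions d = {V. \<forall>i j. (Vert i j \<notin> darkened d \<longrightarrow> col_partial_sum V i j = 0) \<and>
                           (Horiz i j \<notin> darkened d \<longrightarrow> row_partial_sum V i j = 0)}"

lemma darkened_Vert: "Vert i j \<in> darkened d \<longleftrightarrow> d (Vert i j) = Values {0, 1}"
  and darkened_Horiz: "Horiz i j \<in> darkened d \<longleftrightarrow> d (Horiz i j) = Star"
  by (auto simp: darkened_def)

lemma darkened_component_of:
  fixes S :: "(real^'n::{finite,linorder}^'m::{finite,linorder}) set"
  assumes "S \<noteq> {}" "S \<subseteq> sign_matrices p"
  shows "Vert i j \<in> darkened (component_of p S) \<longleftrightarrow>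
      (\<exists>X\<in>S. col_partial_sum X i j = 0) \<and> (\<exists>X\<in>S. col_partial_sum X i j = 1)"
    and "Horiz i j \<in> darkened (component_of p S) \<longleftrightarrow>
      pos j < CARD('n) \<and> (\<exists>X\<in>S. row_partial_sum X i j \<noteq> 0)"
proof -
  let ?c = "(\<lambda>X. col_partial_sum X i j) ` S"
  have "?c \<subseteq> {0, 1}"
    using sign_matrix_col_partial_sum[OF subsetD[OF assms(2)]] by (intro image_subsetI)
  hence "?c = {0, 1} \<longleftrightarrow> 0 \<in> ?c \<and> 1 \<in> ?c" by blast
  also have "\<dots> \<longleftrightarrow> (\<exists>X\<in>S. col_partial_sum X i j = 0) \<and> (\<exists>X\<in>S. col_partial_sum X i j = 1)"
    by (simp only: image_iff eq_commute[of 0] eq_commute[of 1])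
  finally show "Vert i j \<in> darkened (component_of p S) \<longleftrightarrow>
      (\<exists>X\<in>S. col_partial_sum X i j = 0) \<and> (\<exists>X\<in>S. col_partial_sum X i j = 1)"
    by (simp add: darkened_Vert component_of_apply[OF assms(1)])
  show "Horiz i j \<in> darkened (component_of p S) \<longleftrightarrow>
      pos j < CARD('n) \<and> (\<exists>X\<in>S. row_partial_sum X i j \<noteq> 0)"
    by (simp add: darkened_Horiz component_of_apply[OF assms(1)])
qed

lemma exists_last: "\<exists>j :: 'n::{finite,linorder}. pos j = CARD('n)"
  using pos_surj[of "CARD('n)", where 'a = 'n] by (metis One_nat_def Suc_leI order_refl zero_less_card_finite)

text \<open>Translate a relative interior point \<open>W\<close> of \<open>F\<close> to the origin.
  All points of \<open>F\<close> have the same partial sums on undarkened edges, so the translate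
  consists of directions. Conversely \<open>W\<close> can be moved a little in any direction without
  leaving \<open>F\<close>, so the translate spans the directions.\<close>

lemma aff_dim_face:
  fixes F :: "(real^'n::{finite,linorder}^'m::{finite,linorder}) set"
  assumes F: "F face_of flow_polytope p" and "F \<noteq> {}"
  shows "aff_dim F = int (dim (directions (psi p F) :: (real^'n::{finite,linorder}^'m::{finite,linorder}) set))"
proof -
  let ?S = "sign_matrices p \<inter> F"
  let ?D = "directions (component_of p ?S) :: (real^'n::{finite,linorder}^'m::{finite,linorder}) set"
  have S: "?S \<noteq> {}" "?S \<subseteq> sign_matrices p" using face_sign_matrices_nonempty[OF F] assms by auto
  have conv: "convex F" and sub: "F \<subseteq> flow_polytope p"
    using F face_of_imp_convex face_of_imp_subset by blast+
  obtain W where W: "W \<in> rel_interior F" using assms(2) rel_interior_eq_empty[OF conv] by blast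
  have WF: "W \<in> F" using W rel_interior_subset by blast
  have tight: "tight_face p ?S = F" by (rule tight_face_of_face[OF assms])
  note rel = rel_interior_flow_face[OF conv sub W]
  note dark = darkened_component_of[OF S]
  let ?Z = "(\<lambda>x. - W + x) ` F"
  have "?Z \<subseteq> ?D"
  proof
    fix V assume "V \<in> ?Z"
    then obtain X where X: "X \<in> F" "V = X - W" by auto
    have cF: "(\<forall>Y\<in>?S. col_partial_sum Y i j = 0) \<longrightarrow> col_partial_sum Z i j = 0"
      "(\<forall>Y\<in>?S. col_partial_sum Y i j = 1) \<longrightarrow> col_partial_sum Z i j = 1"
      "(\<forall>Y\<in>?S. row_partial_sum Y i j = 0) \<longrightarrow> row_partial_sum Z i j = 0" if "Z \<in> F" for Z i j
    proof -
      have "Z \<in> tight_face p ?S" using that by (simp only: tight)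
      thus "(\<forall>Y\<in>?S. col_partial_sum Y i j = 0) \<longrightarrow> col_partial_sum Z i j = 0"
        "(\<forall>Y\<in>?S. col_partial_sum Y i j = 1) \<longrightarrow> col_partial_sum Z i j = 1"
        "(\<forall>Y\<in>?S. row_partial_sum Y i j = 0) \<longrightarrow> row_partial_sum Z i j = 0"
        unfolding tight_face_def by blast+
    qed
    have "col_partial_sum V i j = 0" if "Vert i j \<notin> darkened (component_of p ?S)" for i j
    proof -
      have "col_partial_sum Y i j = 0 \<or> col_partial_sum Y i j = 1" if "Y \<in> ?S" for Y
        using that sign_matrix_col_partial_sum[of Y p i j] by simp
      hence "(\<forall>Y\<in>?S. col_partial_sum Y i j = 0) \<or> (\<forall>Y\<in>?S. col_partial_sum Y i j = 1)"
        using that unfolding dark by blast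
      thus ?thesis using cF(1,2)[OF X(1), of i j] cF(1,2)[OF WF, of i j]
        by (auto simp: X(2) partial_sum_linear_simps)
    qed
    moreover have "row_partial_sum V i j = 0" if "Horiz i j \<notin> darkened (component_of p ?S)" for i j
    proof (cases "pos j < CARD('n)")
      case True
      hence "\<forall>Y\<in>?S. row_partial_sum Y i j = 0" using that unfolding dark by blast
      thus ?thesis using cF(3)[OF X(1), of i j] cF(3)[OF WF, of i j]
        by (auto simp: X(2) partial_sum_linear_simps)
    next
      case False
      \<comment> \<open>Final edges are never darkened whatever the row total is; here the jump
        vanishes because all points of the polytope have equal row totals.\<close>
      hence "pos j = CARD('n)" using pos_le_card[of j] by simp
      moreover have "(\<Sum>j\<in>UNIV. V $ i $ j) = 0"
        unfolding X(2) by (rule row_total_constant[OF subsetD[OF sub X(1)] subsetD[OF sub WF]])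
      ultimately show ?thesis by (simp add: row_partial_sum_last)
    qed
    ultimately show "V \<in> ?D" by (simp add: directions_def)
  qed
  hence "dim ?Z \<le> dim ?D" by (rule dim_subset)
  moreover have "?D \<subseteq> span ?Z"
  proof
    fix V assume V: "V \<in> ?D"
    hence V0: "Vert i j \<notin> darkened (component_of p ?S) \<Longrightarrow> col_partial_sum V i j = 0"
      "Horiz i j \<notin> darkened (component_of p ?S) \<Longrightarrow> row_partial_sum V i j = 0" for i j
      by (auto simp: directions_def)
    have W01: "col_partial_sum V i j = 0" if "col_partial_sum W i j \<in> {0, 1}" for i j
    proof (rule V0)
      have "(\<forall>Y\<in>?S. col_partial_sum Y i j = 0) \<or> (\<forall>Y\<in>?S. col_partial_sum Y i j = 1)"
        using that rel(1,2)[of _ i j] by blast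
      thus "Vert i j \<notin> darkened (component_of p ?S)" unfolding dark by force
    qed
    have W0: "row_partial_sum V i j = 0" if "row_partial_sum W i j = 0" for i j
    proof (rule V0)
      have "\<forall>Y\<in>?S. row_partial_sum Y i j = 0" using rel(3)[OF _ that] by blast
      thus "Horiz i j \<notin> darkened (component_of p ?S)" unfolding dark by blast
    qed
    \<comment> \<open>In turn, undarkened final edges force a direction to have row sums
      \<open>0\<close>, as a perturbation inside the polytope requires.\<close>
    obtain jl :: 'n where jl: "pos jl = CARD('n)" using exists_last by blast
    obtain e where e: "0 < e" "\<And>t. \<bar>t\<bar> \<le> e \<Longrightarrow> W + t *\<^sub>R V \<in> flow_polytope p"
    proof (rule flow_polytope_perturbation[of W p V])
      show "W \<in> flow_polytope p" using WF sub by blast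
      show "(\<Sum>j\<in>UNIV. V $ i $ j) = 0" for i
      proof -
        have "row_partial_sum V i jl = 0" by (rule V0) (simp add: dark jl)
        thus ?thesis by (simp add: row_partial_sum_last[OF jl])
      qed
    qed (use that W01 W0 in blast)+
    have WT: "W \<in> tight_face p ?S" using WF by (simp only: tight)
    have "W + e *\<^sub>R V \<in> tight_face p ?S"
      unfolding tight_face_def
    proof (intro CollectI conjI allI impI)
      show "W + e *\<^sub>R V \<in> flow_polytope p" using e by simp
      fix i j
      show "col_partial_sum (W + e *\<^sub>R V) i j = 0" if "\<forall>Y\<in>?S. col_partial_sum Y i j = 0"
      proof -
        have "col_partial_sum W i j = 0" using WT that unfolding tight_face_def by blast
        thus ?thesis using W01[of i j] by (simp add: partial_sum_linear_simps)
      qed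
      show "col_partial_sum (W + e *\<^sub>R V) i j = 1" if "\<forall>Y\<in>?S. col_partial_sum Y i j = 1"
      proof -
        have "col_partial_sum W i j = 1" using WT that unfolding tight_face_def by blast
        thus ?thesis using W01[of i j] by (simp add: partial_sum_linear_simps)
      qed
      show "row_partial_sum (W + e *\<^sub>R V) i j = 0" if "\<forall>Y\<in>?S. row_partial_sum Y i j = 0"
      proof -
        have "row_partial_sum W i j = 0" using WT that unfolding tight_face_def by blast
        thus ?thesis using W0[of i j] by (simp add: partial_sum_linear_simps)
      qed
    qed
    hence "e *\<^sub>R V \<in> ?Z" unfolding tight by (intro image_eqI[of _ _ "W + e *\<^sub>R V"]) auto
    hence "(1 / e) *\<^sub>R (e *\<^sub>R V) \<in> span ?Z" by (intro span_mul span_base)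
    thus "V \<in> span ?Z" using e by simp
  qed
  hence "dim ?D \<le> dim ?Z" using dim_subset[of ?D "span ?Z"] by (simp only: dim_span)
  ultimately have "dim ?Z = dim ?D" by (rule order_antisym)
  moreover have "aff_dim F = int (dim ?Z)"
    by (rule aff_dim_eq_dim) (simp add: WF hull_inc)
  ultimately show ?thesis using psi_eq_component_of[OF F] by simp
qed

section \<open>The drawing of a labeling as a drawing on the grid of cells\<close>

definition dark_vert :: "('m::{finite,linorder}, 'n::{finite,linorder}) labeling \<Rightarrow> nat \<Rightarrow> nat \<Rightarrow> bool" where
  "dark_vert d s t \<longleftrightarrow> (\<exists>i j. pos i = s \<and> pos j = t \<and> Vert i j \<in> darkened d)"

definition dark_horiz :: "('m::{finite,linorder}, 'n::{finite,linorder}) labeling \<Rightarrow> nat \<Rightarrow> nat \<Rightarrow> bool" where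
  "dark_horiz d s t \<longleftrightarrow> (\<exists>i j. pos i = s \<and> pos j = t \<and> Horiz i j \<in> darkened d)"

lemma dark_vert_pos [simp]: "dark_vert d (pos i) (pos j) \<longleftrightarrow> Vert i j \<in> darkened d"
  by (auto simp: dark_vert_def)

lemma dark_horiz_pos [simp]: "dark_horiz d (pos i) (pos j) \<longleftrightarrow> Horiz i j \<in> darkened d"
  by (auto simp: dark_horiz_def)

lemma (in grid_drawing) closed_segment_vertical:
  assumes "1 \<le> i" "i \<le> m" "1 \<le> j" "j \<le> n"
  shows "closed_segment (vertex_point m n (i, j)) (vertex_point m n (i + 1, j)) = vseg i j"
proof -
  have ends: "vertex_point m n (i, j) = (line i j (- real i), - real i)"
    "vertex_point m n (i + 1, j) = (line i j (- real i - 1), - real i - 1)"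
    using assms by (auto simp: vertex_point_def line_def)
  show ?thesis
  proof (intro equalityI subsetI)
    fix z assume "z \<in> closed_segment (vertex_point m n (i, j)) (vertex_point m n (i + 1, j))"
    then obtain u where u: "0 \<le> u" "u \<le> 1"
      "z = (1 - u) *\<^sub>R (line i j (- real i), - real i) + u *\<^sub>R (line i j (- real i - 1), - real i - 1)"
      unfolding ends in_segment by blast
    have y: "(1 - u) * (- real i) + u * (- real i - 1) = - real i - u" by (simp add: algebra_simps)
    have "z = ((1 - u) * line i j (- real i) + u * line i j (- real i - 1),
        (1 - u) * (- real i) + u * (- real i - 1))"
      using u(3) by simp
    hence "z = (line i j (- real i - u), - real i - u)"
      unfolding line_combination[symmetric] y .
    thus "z \<in> vseg i j" using u(1,2) by (simp add: vseg_def)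
  next
    fix z assume "z \<in> vseg i j"
    then obtain y where y: "z = (line i j y, y)" "- real i - 1 \<le> y" "y \<le> - real i"
      by (auto simp: vseg_def)
    define u where "u = - real i - y"
    have yu: "y = (1 - u) * (- real i) + u * (- real i - 1)" by (simp add: u_def algebra_simps)
    have "line i j y = (1 - u) * line i j (- real i) + u * line i j (- real i - 1)"
      by (subst yu) (rule line_combination)
    hence "z = (1 - u) *\<^sub>R (line i j (- real i), - real i) + u *\<^sub>R (line i j (- real i - 1), - real i - 1)"
      unfolding y(1) using yu by simp
    thus "z \<in> closed_segment (vertex_point m n (i, j)) (vertex_point m n (i + 1, j))"
      unfolding in_segment ends using y by (intro exI[of _ u]) (auto simp: u_def)
  qed
qed

lemma (in grid_drawing) closed_segment_horizontal:
  assumes "1 \<le> i" "i \<le> m" "1 \<le> j" "j < n"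
  shows "closed_segment (vertex_point m n (i, j)) (vertex_point m n (i, j + 1)) = hseg i j"
proof -
  have ends: "vertex_point m n (i, j) = (real j, - real i)"
    "vertex_point m n (i, j + 1) = (real j + 1, - real i)"
    using assms by (auto simp: vertex_point_def)
  show ?thesis
  proof (intro equalityI subsetI)
    fix z assume "z \<in> closed_segment (vertex_point m n (i, j)) (vertex_point m n (i, j + 1))"
    then obtain u where u: "0 \<le> u" "u \<le> 1"
      "z = (1 - u) *\<^sub>R (real j, - real i) + u *\<^sub>R (real j + 1, - real i)"
      unfolding ends in_segment by blast
    hence "z = (real j + u, - real i)" by (simp add: algebra_simps)
    thus "z \<in> hseg i j" using u(1,2) by (simp add: hseg_def)
  next
    fix z assume "z \<in> hseg i j"
    then obtain x where x: "z = (x, - real i)" "real j \<le> x" "x \<le> real j + 1" by (auto simp: hseg_def)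
    have "z = (1 - (x - real j)) *\<^sub>R (real j, - real i) + (x - real j) *\<^sub>R (real j + 1, - real i)"
      unfolding x(1) by (simp add: algebra_simps)
    thus "z \<in> closed_segment (vertex_point m n (i, j)) (vertex_point m n (i, j + 1))"
      unfolding in_segment ends using x(2,3) by (intro exI[of _ "x - real j"]) simp
  qed
qed

text \<open>Cells use the indices \<open>0\<close> and \<open>Suc m\<close>, which have no
  counterpart in the index types, so darkened edges are transported to positions. The hypothesis
  excludes final horizontal edges, for which \<open>drawn\<close> has no segment.\<close>

lemma drawing_eq_drawn:
  fixes d :: "('m::{finite,linorder}, 'n::{finite,linorder}) labeling"
  assumes last: "\<And>i j. Horiz i j \<in> darkened d \<Longrightarrow> pos j < CARD('n)"
  shows "drawing d = grid_drawing.drawn CARD('m) CARD('n) (dark_vert d) (dark_horiz d)"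
proof -
  interpret grid_drawing "CARD('m)" "CARD('n)" "dark_vert d" "dark_horiz d"
    by unfold_locales simp_all
  let ?seg = "\<lambda>e :: ('m, 'n) edge. closed_segment (vertex_point CARD('m) CARD('n) (fst (edge_ends e)))
                    (vertex_point CARD('m) CARD('n) (snd (edge_ends e)))"
  have V: "?seg (Vert i j) = vseg (pos i) (pos j)" for i j
    using closed_segment_vertical[OF pos_ge_1 pos_le_card pos_ge_1 pos_le_card] by simp
  have H: "?seg (Horiz i j) = hseg (pos i) (pos j)" if "Horiz i j \<in> darkened d" for i j
    using closed_segment_horizontal[OF pos_ge_1 pos_le_card pos_ge_1 last[OF that]] by simp
  show ?thesis
  proof (intro equalityI subsetI)
    fix z assume "z \<in> drawing d"
    then obtain e where e: "e \<in> darkened d" "z \<in> ?seg e" by (auto simp: drawing_def)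
    show "z \<in> drawn"
    proof (cases e)
      case (Vert i j)
      have "vseg (pos i) (pos j) \<subseteq> drawn"
        using e(1) by (intro vseg_subset_drawn) (simp_all add: Vert pos_ge_1[simplified] pos_le_card)
      thus ?thesis using e(2) V[of i j] unfolding Vert by blast
    next
      case (Horiz i j)
      have d: "Horiz i j \<in> darkened d" using e(1) by (simp add: Horiz)
      hence "hseg (pos i) (pos j) \<subseteq> drawn"
        by (intro hseg_subset_drawn) (simp_all add: pos_ge_1[simplified] pos_le_card last)
      thus ?thesis using e(2) H[OF d] unfolding Horiz by blast
    qed
  next
    fix z assume "z \<in> drawn"
    thus "z \<in> drawing d"
    proof (cases rule: drawnE)
      case (vertical s t)
      then obtain i j where "pos i = s" "pos j = t" "Vert i j \<in> darkened d" by (auto simp: dark_vert_def)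
      moreover from this have "z \<in> ?seg (Vert i j)" using V[of i j] vertical by simp
      ultimately show ?thesis unfolding drawing_def by blast
    next
      case (horizontal s t)
      then obtain i j where "pos i = s" "pos j = t" "Horiz i j \<in> darkened d" by (auto simp: dark_horiz_def)
      moreover from this have "z \<in> ?seg (Horiz i j)" using H[of i j] horizontal by simp
      ultimately show ?thesis unfolding drawing_def by blast
    qed
  qed
qed

section \<open>Bounded faces as a basis of the direction space\<close>

lemma corner_sums_determine:
  fixes X Y :: "real^'n::{finite,linorder}^'m::{finite,linorder}"
  assumes "\<And>s t. s \<le> CARD('m) \<Longrightarrow> t \<le> CARD('n) \<Longrightarrow> corner_sum X s t = corner_sum Y s t"
  shows "X = Y"
  by (rule col_partial_sums_determine)
    (simp add: col_partial_sum_corner assms pos_le_card le_trans[OF diff_le_self pos_le_card])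

text \<open>
  A direction is the second difference of its corner sums, which are constant on each face of the
  drawing and vanish on the unbounded one; so the second differences of the indicators of the
  bounded faces form a basis.
\<close>

lemma dim_directions:
  fixes d :: "('m::{finite,linorder}, 'n::{finite,linorder}) labeling"
  assumes last: "\<And>i j. Horiz i j \<in> darkened d \<Longrightarrow> pos j < CARD('n)"
  shows "dim (directions d :: (real^'n::{finite,linorder}^'m::{finite,linorder}) set) =
    card {C \<in> components (- drawing d). bounded C}"
proof -
  let ?m = "CARD('m)" and ?n = "CARD('n)"
  interpret grid_drawing "CARD('m)" "CARD('n)" "dark_vert d" "dark_horiz d"
    by unfold_locales simp_all
  define B where "B = {C \<in> components (- drawn). bounded C}"
  \<comment> \<open>The range guard makes the indicator vanish at indices that belong to no cell.
    The conditions on the axes then hold for all indices, as \<open>of_heights\<close>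
    demands.\<close>
  define h where "h C s t = (if s \<le> ?m \<and> t \<le> ?n \<and> inner_point s t \<in> C then 1 else 0 :: real)" for C s t
  define E :: "(real \<times> real) set \<Rightarrow> real^'n::{finite,linorder}^'m::{finite,linorder}"
    where "E C = of_heights (h C)" for C
  let ?comp = "\<lambda>s t. connected_component_set (- drawn) (inner_point s t)"
  have comp: "C = ?comp s t" if "C \<in> components (- drawn)" "inner_point s t \<in> C" for C s t
  proof -
    have "C \<in> connected_component_set (- drawn) ` (- drawn)" using that(1) by (simp only: components_def)
    then obtain z where z: "C = connected_component_set (- drawn) z" by blast
    moreover have "connected_component_set (- drawn) z = ?comp s t"
      by (rule connected_component_eq[symmetric]) (use that(2) z in simp)
    ultimately show ?thesis by simp
  qed
  have comp_in: "?comp s t \<in> components (- drawn)" if "s \<le> ?m" for s t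
    unfolding components_def using inner_point_notin_drawn[of s t] that by (intro imageI) simp
  have self: "inner_point s t \<in> ?comp s t" if "s \<le> ?m" for s t
    using inner_point_notin_drawn[of s t] that by (simp add: connected_component_refl_eq)
  have obtain_point: "\<exists>s t. s \<le> ?m \<and> t \<le> ?n \<and> inner_point s t \<in> C \<and> C = ?comp s t" if C: "C \<in> B" for C
  proof -
    have CC: "C \<in> components (- drawn)" and bC: "bounded C" using C by (simp_all add: B_def)
    obtain z where z: "z \<in> - drawn" "C = connected_component_set (- drawn) z"
      using CC unfolding components_def by (elim imageE)
    obtain s t where st: "s \<le> ?m" "t < ?n" "connected_component (- drawn) z (inner_point s t)"
      using bounded_component_has_inner_point[of z] z(1) bC[unfolded z(2)] by blast
    have "inner_point s t \<in> C" using st(3) by (simp add: z(2))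
    thus ?thesis
      using comp[OF CC, of s t] st(1,2) by (intro exI[of _ s] exI[of _ t] conjI) simp_all
  qed
  have fin: "finite B"
  proof (rule finite_subset)
    show "B \<subseteq> (\<lambda>(s, t). ?comp s t) ` ({..?m} \<times> {..?n})"
    proof
      fix C assume "C \<in> B"
      then obtain s t where "s \<le> ?m" "t \<le> ?n" "C = ?comp s t" using obtain_point by blast
      thus "C \<in> (\<lambda>(s, t). ?comp s t) ` ({..?m} \<times> {..?n})"
        by (intro image_eqI[of _ _ "(s, t)"]) simp_all
    qed
  qed simp
  have ext: "h C s t = 0" if "C \<in> B" "exterior s t" for C s t
  proof (rule ccontr)
    assume "h C s t \<noteq> 0"
    hence st: "s \<le> ?m" "inner_point s t \<in> C" by (simp_all add: h_def split: if_splits)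
    have "\<not> bounded (?comp s t)" using exterior_unbounded[OF that(2)] st(1) by simp
    moreover have "C = ?comp s t" by (rule comp) (use that(1) st(2) B_def in simp_all)
    ultimately show False using that(1) by (simp add: B_def)
  qed
  have h0: "h C 0 t = 0" "h C s 0 = 0" if "C \<in> B" for C s t
    by (simp_all add: ext[OF that] exterior_def)
  have cornerE: "corner_sum (E C) s t = h C s t" if "C \<in> B" "s \<le> ?m" "t \<le> ?n" for C s t
    unfolding E_def using h0[OF that(1)] that(2,3) by (intro corner_sum_of_heights) simp_all
  have h_eq: "h C s t = h C s' t'"
    if "connected_component (- drawn) (inner_point s t) (inner_point s' t')" "C \<in> B"
      "s \<le> ?m" "t \<le> ?n" "s' \<le> ?m" "t' \<le> ?n" for C s t s' t'
  proof -
    have "?comp s t = ?comp s' t'" by (rule connected_component_eq[symmetric]) (use that(1) in simp)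
    moreover have "inner_point a b \<in> C \<longleftrightarrow> C = ?comp a b" if "a \<le> ?m" for a b
    proof
      assume "inner_point a b \<in> C"
      thus "C = ?comp a b" by (intro comp) (use \<open>C \<in> B\<close> B_def in simp_all)
    next
      assume "C = ?comp a b"
      thus "inner_point a b \<in> C" using self[OF that] by blast
    qed
    ultimately have "inner_point s t \<in> C \<longleftrightarrow> inner_point s' t' \<in> C"
      using that(3,5) by simp
    thus ?thesis using that(3-6) by (simp add: h_def)
  qed
  have E_dir: "E C \<in> directions d" if C: "C \<in> B" for C
  proof -
    have "col_partial_sum (E C) i j = 0" if "Vert i j \<notin> darkened d" for i j
    proof -
      have "h C (pos i) (pos j - 1) = h C (pos i) (pos j)"
        using that C pos_ge_1[of i] pos_ge_1[of j] pos_le_card[of i] pos_le_card[of j]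
        by (intro h_eq connected_component_across_vertical) simp_all
      thus ?thesis unfolding E_def partial_sums_of_heights(1)[of "h C", OF h0[OF C]] by simp
    qed
    moreover have "row_partial_sum (E C) i j = 0" if "Horiz i j \<notin> darkened d" for i j
    proof (cases "pos j < ?n")
      case True
      have "h C (pos i - 1) (pos j) = h C (pos i) (pos j)"
        using that C True pos_ge_1[of i] pos_ge_1[of j] pos_le_card[of i] pos_le_card[of j]
        by (intro h_eq connected_component_across_horizontal) simp_all
      thus ?thesis unfolding E_def partial_sums_of_heights(2)[of "h C", OF h0[OF C]] by simp
    next
      case False
      hence "pos j = ?n" using pos_le_card[of j] by simp
      thus ?thesis unfolding E_def partial_sums_of_heights(2)[of "h C", OF h0[OF C]]
        using ext[OF C] by (simp add: exterior_def)
    qed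
    ultimately show ?thesis by (simp add: directions_def)
  qed
  have corner_combination: "corner_sum (\<Sum>C\<in>B. a C *\<^sub>R E C) s t = (\<Sum>C\<in>B. a C * h C s t)"
    if "s \<le> ?m" "t \<le> ?n" for a s t
    using that by (simp add: linear_sum[OF linear_corner_sum] partial_sum_linear_simps cornerE)
  \<comment> \<open>The point of a cell lies in exactly one component, so each corner sum of a
    combination reads off a single coefficient. Independence and spanning both rest on this.\<close>
  have combination_at: "(\<Sum>C\<in>B. a C * h C s t) = (if ?comp s t \<in> B then a (?comp s t) else 0)"
    if st: "s \<le> ?m" "t \<le> ?n" for a s t
  proof -
    have "a C * h C s t = (if C = ?comp s t then a C else 0)" if "C \<in> B" for C
    proof (cases "inner_point s t \<in> C")
      case True
      moreover from this have "C = ?comp s t" using that by (intro comp) (simp_all add: B_def)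
      ultimately show ?thesis using st by (simp add: h_def)
    next
      case False
      moreover from this have "C \<noteq> ?comp s t" using self[OF st(1)] by blast
      ultimately show ?thesis by (simp add: h_def)
    qed
    hence "(\<Sum>C\<in>B. a C * h C s t) = (\<Sum>C\<in>B. if C = ?comp s t then a C else 0)"
      by (rule sum.cong[OF refl])
    also have "\<dots> = (if ?comp s t \<in> B then a (?comp s t) else 0)" using fin by (simp add: sum.delta)
    finally show ?thesis .
  qed
  have coefficient_zero: "a C = 0" if sum0: "(\<Sum>C\<in>B. a C *\<^sub>R E C) = 0" and C: "C \<in> B" for a C
  proof -
    obtain s t where st: "s \<le> ?m" "t \<le> ?n" "C = ?comp s t" using obtain_point[OF C] by blast
    have "0 = corner_sum (\<Sum>C\<in>B. a C *\<^sub>R E C) s t"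
      unfolding sum0 by (rule linear_0[OF linear_corner_sum, symmetric])
    also have "\<dots> = (\<Sum>C\<in>B. a C * h C s t)" by (rule corner_combination[OF st(1,2)])
    finally have "(\<Sum>C\<in>B. a C * h C s t) = 0" by (rule sym)
    thus ?thesis using C unfolding combination_at[OF st(1,2), of a] st(3)[symmetric] by simp
  qed
  have inj: "inj_on E B"
  proof (rule inj_onI)
    fix C C' assume C: "C \<in> B" "C' \<in> B" "E C = E C'"
    obtain s t where st: "s \<le> ?m" "t \<le> ?n" "inner_point s t \<in> C" using obtain_point[OF C(1)] by blast
    have "h C s t = h C' s t"
      using cornerE[OF C(1) st(1,2)] cornerE[OF C(2) st(1,2)] C(3) by simp
    hence "inner_point s t \<in> C'" using st by (simp add: h_def split: if_splits)
    hence "C' = ?comp s t" by (intro comp) (use C(2) B_def in simp_all)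
    moreover have "C = ?comp s t" using C(1) st(3) by (intro comp) (simp_all add: B_def)
    ultimately show "C = C'" by simp
  qed
  have indep: "independent (E ` B)"
  proof (rule independent_if_scalars_zero)
    fix f x assume f: "(\<Sum>x\<in>E ` B. f x *\<^sub>R x) = 0" "x \<in> E ` B"
    have "(\<Sum>C\<in>B. f (E C) *\<^sub>R E C) = 0" using f(1) by (simp add: sum.reindex[OF inj])
    thus "f x = 0" using coefficient_zero[of "\<lambda>C. f (E C)"] f(2) by auto
  qed (use fin in simp)
  have span: "directions d \<subseteq> span (E ` B)"
  proof
    fix V :: "real^'n::{finite,linorder}^'m::{finite,linorder}" assume V: "V \<in> directions d"
    \<comment> \<open>Below the last row \<open>corner_sum V\<close> merely repeats its values of
      that row, whereas the half plane below is exterior and needs height \<open>0\<close>. No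
      condition on edges links the rows \<open>m\<close> and \<open>Suc m\<close>, so the value can
      be reset.\<close>
    define H where "H s t = (if s = Suc ?m then 0 else corner_sum V s t)" for s t
    have c0: "col_partial_sum V i j = 0" if "Vert i j \<notin> darkened d" for i j
      using V that by (simp add: directions_def)
    have r0: "row_partial_sum V i j = 0" if "Horiz i j \<notin> darkened d" for i j
      using V that by (simp add: directions_def)
    have last0: "corner_sum V s ?n = 0" for s
    proof -
      obtain jl :: 'n where jl: "pos jl = ?n" using exists_last by blast
      have "(\<Sum>j\<in>UNIV. V $ i $ j) = 0" for i
        using r0[of i jl] last[of i jl] jl row_partial_sum_last[OF jl, of V i] by auto
      thus ?thesis by (simp add: corner_sum_def pos_le_card)
    qed
    have "height H"
      unfolding height_def
    proof (intro conjI allI ballI impI)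
      show "H s t = 0" if "exterior s t" for s t
        using that by (auto simp: H_def exterior_def last0)
      show "H s (t - 1) = H s t" if st: "s \<in> {1..?m}" "t \<in> {1..?n}" "\<not> dark_vert d s t" for s t
      proof -
        have range: "1 \<le> s" "s \<le> ?m" "1 \<le> t" "t \<le> ?n" using st(1,2) by simp_all
        obtain i :: 'm where i: "pos i = s" by (rule pos_surj[OF range(1,2)])
        obtain j :: 'n where j: "pos j = t" by (rule pos_surj[OF range(3,4)])
        have "col_partial_sum V i j = 0" by (rule c0) (use st(3) dark_vert_pos[of d i j] i j in simp)
        thus ?thesis using st(1) by (simp add: H_def col_partial_sum_corner i j)
      qed
      show "H (s - 1) t = H s t" if st: "s \<in> {1..?m}" "t \<in> {1..<?n}" "\<not> dark_horiz d s t" for s t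
      proof -
        have range: "1 \<le> s" "s \<le> ?m" "1 \<le> t" "t \<le> ?n" using st(1,2) by simp_all
        obtain i :: 'm where i: "pos i = s" by (rule pos_surj[OF range(1,2)])
        obtain j :: 'n where j: "pos j = t" by (rule pos_surj[OF range(3,4)])
        have "row_partial_sum V i j = 0" by (rule r0) (use st(3) dark_horiz_pos[of d i j] i j in simp)
        moreover have "s \<noteq> Suc ?m" "s - 1 \<noteq> Suc ?m" using st(1) by auto
        ultimately show ?thesis by (simp add: H_def row_partial_sum_corner i j)
      qed
    qed
    \<comment> \<open>The coefficient of a face is the height of any cell in it; the choice does not
      matter because heights are constant on components.\<close>
    define a where "a C = (SOME v. \<exists>s\<le>?m. \<exists>t\<le>?n. inner_point s t \<in> C \<and> v = H s t)" for C
    have a: "a (?comp s t) = H s t" if st: "s \<le> ?m" "t \<le> ?n" for s t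
    proof -
      have "\<exists>v. \<exists>s'\<le>?m. \<exists>t'\<le>?n. inner_point s' t' \<in> ?comp s t \<and> v = H s' t'"
        using self[of s t] st by blast
      hence "\<exists>s'\<le>?m. \<exists>t'\<le>?n. inner_point s' t' \<in> ?comp s t \<and> a (?comp s t) = H s' t'"
        unfolding a_def by (rule someI_ex)
      then obtain s' t' where s't': "s' \<le> ?m" "t' \<le> ?n" "inner_point s' t' \<in> ?comp s t"
        "a (?comp s t) = H s' t'"
        by blast
      have "H s t = H s' t'"
        by (rule height_component[OF \<open>height H\<close>]) (use st s't' in simp_all)
      thus ?thesis using s't'(4) by simp
    qed
    have "V = (\<Sum>C\<in>B. a C *\<^sub>R E C)"
    proof (rule corner_sums_determine)
      fix s t assume st: "s \<le> ?m" "t \<le> ?n"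
      \<comment> \<open>Unbounded components have no basis vector, which is consistent because the
        height vanishes on them.\<close>
      have "H s t = 0" if "?comp s t \<notin> B"
      proof (rule height_unbounded_component[OF \<open>height H\<close>])
        show "\<not> bounded (?comp s t)" using that comp_in[OF st(1), of t] by (simp add: B_def)
      qed (use st in simp_all)
      hence "(\<Sum>C\<in>B. a C * h C s t) = H s t"
        by (cases "?comp s t \<in> B") (simp_all add: combination_at[OF st, of a] a[OF st])
      thus "corner_sum V s t = corner_sum (\<Sum>C\<in>B. a C *\<^sub>R E C) s t"
        using corner_combination[OF st, of a] st by (simp add: H_def)
    qed
    moreover have "(\<Sum>C\<in>B. a C *\<^sub>R E C) \<in> span (E ` B)"
      by (intro span_sum span_mul span_base imageI)
    ultimately show "V \<in> span (E ` B)" by simp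
  qed
  have "dim (directions d :: (real^'n::{finite,linorder}^'m::{finite,linorder}) set) = card (E ` B)"
    by (rule dim_unique[OF _ span indep refl]) (use E_dir in blast)
  also have "\<dots> = card B" by (rule card_image[OF inj])
  finally show ?thesis using drawing_eq_drawn[of d] last by (simp add: B_def)
qed

lemma aff_dim_eq_regions:
  fixes F :: "(real^'n::{finite,linorder}^'m::{finite,linorder}) set"
  assumes F: "F face_of flow_polytope p"
  shows "aff_dim F = regions (psi p F)"
proof (cases "F = {}")
  case True
  thus ?thesis by (simp add: psi_empty regions_def)
next
  case False
  let ?S = "sign_matrices p \<inter> F"
  have S: "?S \<noteq> {}" "?S \<subseteq> sign_matrices p" using face_sign_matrices_nonempty[OF F] False by auto
  have "psi p F \<noteq> empty_labeling"
    using component_of_neq_empty[OF S(1)] psi_eq_component_of[OF F] by metis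
  moreover have "dim (directions (psi p F) :: (real^'n::{finite,linorder}^'m::{finite,linorder}) set) =
      card {C \<in> components (- drawing (psi p F)). bounded C}"
    by (rule dim_directions) (simp add: psi_eq_component_of[OF F] darkened_component_of[OF S])
  ultimately show ?thesis by (simp add: aff_dim_face[OF F False] regions_def)
qed

theorem theorem7p20:
  fixes p :: "nat list"
    and P :: "(real ^ 'n::{finite,linorder} ^ 'm::{finite,linorder}) set"
  assumes "is_partition p"
    and "CARD('m) = hd p"
    and "P = sign_polytope p"
  shows "bij_betw (psi p) {F. F face_of P} (grid_components p)
    \<and> (\<forall>F G. F face_of P \<longrightarrow> G face_of P \<longrightarrow> (F \<subseteq> G \<longleftrightarrow> labeling_le (psi p F) (psi p G)))
    \<and> (\<forall>F. F face_of P \<longrightarrow> aff_dim F = regions (psi p F))"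
  unfolding assms(3) sign_polytope_eq_flow_polytope
  by (intro conjI allI impI psi_bij_betw psi_le_iff aff_dim_eq_regions)

end
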